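(* Subset Odd Cycle Transversal can be solved in polynomial time for $P_4$-free graphs.
   Context: For a graph $G=(V,E)$ and $T\subseteq V$, an odd $T$-cycle is a cycle of $G$ with an odd number of vertices that contains a vertex of $T$, and an odd $T$-cycle transversal is a set $S_T\subseteq V$ containing at least one vertex of every odd $T$-cycle. The problem Subset Odd Cycle Transversal takes as input a graph $G=(V,E)$, a subset $T\subseteq V$ and a positive integer $k$, and asks whether $G$ has an odd $T$-cycle transversal of size at most $k$. $P_4$ is the path on 4 vertices; a graph is $P_4$-free if it has no induced subgraph isomorphic to $P_4$. *)

theory Defs
  imports "HOL-Computational_Algebra.Polynomial" "HOL-Library.Discrete_Functions"
begin

section \<open>Graphs\<close>

record 'a graph =
  verts :: "'a set"
  edges :: "'a set set"

definition simple_graph :: "'a graph \<Rightarrow> bool" where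
  "simple_graph G \<longleftrightarrow>
     finite (verts G) \<and> (\<forall>e\<in>edges G. e \<subseteq> verts G \<and> card e = 2)"

definition induced_subgraph :: "'a graph \<Rightarrow> 'a set \<Rightarrow> 'a graph" where
  "induced_subgraph G U = \<lparr>verts = U, edges = {e \<in> edges G. e \<subseteq> U}\<rparr>"

definition isomorphic :: "'a graph \<Rightarrow> 'b graph \<Rightarrow> bool" where
  "isomorphic G H \<longleftrightarrow>
     (\<exists>f. bij_betw f (verts G) (verts H) \<and>
          (\<forall>u\<in>verts G. \<forall>v\<in>verts G. {u, v} \<in> edges G \<longleftrightarrow> {f u, f v} \<in> edges H))"

definition free_of :: "'b graph \<Rightarrow> 'a graph \<Rightarrow> bool" where
  "free_of H G \<longleftrightarrow> \<not> (\<exists>U\<subseteq>verts G. isomorphic (induced_subgraph G U) H)"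

text \<open>The path on \<open>r\<close> vertices.\<close>

definition path_graph :: "nat \<Rightarrow> nat graph" where
  "path_graph r = \<lparr>verts = {..<r}, edges = {{i, Suc i} | i. Suc i < r}\<rparr>"

text \<open>
  A cycle (not necessarily induced) is given by the list of its vertices in cyclic order.
\<close>

definition is_cycle :: "'a graph \<Rightarrow> 'a list \<Rightarrow> bool" where
  "is_cycle G c \<longleftrightarrow>
     length c \<ge> 3 \<and> distinct c \<and> set c \<subseteq> verts G \<and>
     (\<forall>i. Suc i < length c \<longrightarrow> {c ! i, c ! Suc i} \<in> edges G) \<and>
     {last c, hd c} \<in> edges G"


section \<open>Subset Odd Cycle Transversal\<close>

definition odd_T_cycle :: "'a graph \<Rightarrow> 'a set \<Rightarrow> 'a list \<Rightarrow> bool" where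
  "odd_T_cycle G T c \<longleftrightarrow> is_cycle G c \<and> odd (length c) \<and> set c \<inter> T \<noteq> {}"

definition odd_T_cycle_transversal :: "'a graph \<Rightarrow> 'a set \<Rightarrow> 'a set \<Rightarrow> bool" where
  "odd_T_cycle_transversal G T S \<longleftrightarrow>
     S \<subseteq> verts G \<and> (\<forall>c. odd_T_cycle G T c \<longrightarrow> set c \<inter> S \<noteq> {})"

text \<open>As usual for inputs of algorithms, the vertices are numbered \<open>0, \<dots>, n - 1\<close>.\<close>

definition soct_instances :: "(nat graph \<times> nat set \<times> nat) set" where
  "soct_instances =
     {(G, T, k). simple_graph G \<and> (\<exists>n. verts G = {..<n}) \<and> T \<subseteq> verts G \<and> 0 < k}"

definition soct_yes :: "(nat graph \<times> nat set \<times> nat) \<Rightarrow> bool" where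
  "soct_yes = (\<lambda>(G, T, k). \<exists>S. odd_T_cycle_transversal G T S \<and> card S \<le> k)"

text \<open>
  An instance is encoded as the number of vertices, the number \<open>k\<close>, the indicator vector of
  \<open>T\<close> and the adjacency matrix in row-major order.
\<close>

definition soct_encode :: "(nat graph \<times> nat set \<times> nat) \<Rightarrow> nat list" where
  "soct_encode = (\<lambda>(G, T, k).
     let n = card (verts G) in
       n # k # map (\<lambda>i. of_bool (i \<in> T)) [0..<n] @
       concat (map (\<lambda>i. map (\<lambda>j. of_bool ({i, j} \<in> edges G)) [0..<n]) [0..<n]))"


section \<open>Random access machines and polynomial time\<close>

text \<open>
  The machine model is the random access machine with unit cost per instruction, with
  addition and (truncated) subtraction as the only arithmetic and with a read-only input, as in
  Papadimitriou, Computational Complexity, Section 2.6. Without multiplication, a register grows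
  by at most one bit per step, so that unit cost is polynomially related to Turing machine
  time. There are infinitely many registers, holding natural numbers and initially \<open>0\<close>.
  In the instructions \<open>r\<close>, \<open>s\<close>, \<open>t\<close> are register numbers (the target comes first), and \<open>l\<close> is an
  absolute position in the program. \<open>Read\<close> accesses the input (it yields \<open>0\<close> beyond its end);
  \<open>Read\<close>, \<open>Load\<close> and \<open>Store\<close> address indirectly.
\<close>

datatype instr =
    Const nat nat
  | Copy nat nat
  | Add nat nat nat
  | Sub nat nat nat
  | Read nat nat
  | Load nat nat
  | Store nat nat
  | Jump nat
  | JumpZero nat nat

type_synonym config = "nat \<times> (nat \<Rightarrow> nat)"

fun exec :: "nat list \<Rightarrow> instr \<Rightarrow> config \<Rightarrow> config" where
  "exec xs (Const r c) (pc, m) = (Suc pc, m(r := c))"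
| "exec xs (Copy r s) (pc, m) = (Suc pc, m(r := m s))"
| "exec xs (Add r s t) (pc, m) = (Suc pc, m(r := m s + m t))"
| "exec xs (Sub r s t) (pc, m) = (Suc pc, m(r := m s - m t))"
| "exec xs (Read r s) (pc, m) = (Suc pc, m(r := if m s < length xs then xs ! m s else 0))"
| "exec xs (Load r s) (pc, m) = (Suc pc, m(r := m (m s)))"
| "exec xs (Store r s) (pc, m) = (Suc pc, m(m r := m s))"
| "exec xs (Jump l) (pc, m) = (l, m)"
| "exec xs (JumpZero r l) (pc, m) = (if m r = 0 then l else Suc pc, m)"

text \<open>
  The machine halts when the program counter leaves the program, and accepts if register \<open>0\<close> is
  then nonzero. Halted configurations are fixed points of \<open>ram_step\<close>.
\<close>

definition halted :: "instr list \<Rightarrow> config \<Rightarrow> bool" where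
  "halted P c \<longleftrightarrow> length P \<le> fst c"

definition ram_step :: "instr list \<Rightarrow> nat list \<Rightarrow> config \<Rightarrow> config" where
  "ram_step P xs c = (if halted P c then c else exec xs (P ! fst c) c)"

definition ram_run :: "instr list \<Rightarrow> nat list \<Rightarrow> nat \<Rightarrow> config" where
  "ram_run P xs t = (ram_step P xs ^^ t) (0, \<lambda>_. 0)"

definition accepting :: "config \<Rightarrow> bool" where
  "accepting c \<longleftrightarrow> snd c 0 \<noteq> 0"

text \<open>
  The input size is the total binary length of the input numbers, where \<open>0\<close> has length \<open>1\<close>
  (note \<open>floor_log 0 = 0\<close>).
\<close>

definition input_size :: "nat list \<Rightarrow> nat" where
  "input_size xs = (\<Sum>x\<leftarrow>xs. floor_log x + 1)"

text \<open>
  The decision problem \<open>yes\<close>, with inputs encoded by \<open>enc\<close> and restricted to the set \<open>I\<close>, is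
  solved in polynomial time by a single program; nothing is required on other inputs.
\<close>

definition poly_time_solvable_on :: "('i \<Rightarrow> nat list) \<Rightarrow> ('i \<Rightarrow> bool) \<Rightarrow> 'i set \<Rightarrow> bool" where
  "poly_time_solvable_on enc yes I \<longleftrightarrow>
     (\<exists>P (p :: nat poly). \<forall>x\<in>I. \<exists>t \<le> poly p (input_size (enc x)).
        halted P (ram_run P (enc x) t) \<and>
        (accepting (ram_run P (enc x) t) \<longleftrightarrow> yes x))"

lemma ram_run_halted:
  assumes "halted P (ram_run P xs t)" "t \<le> t'"
  shows "ram_run P xs t' = ram_run P xs t"
  using assms(2,1)
proof (induction rule: dec_induct)
  case (step n)
  have "ram_run P xs (Suc n) = ram_step P xs (ram_run P xs n)"
    by (simp add: ram_run_def)
  then show ?case using step by (simp add: ram_step_def)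
qed simp

lemma soct_encode_inj: "inj_on soct_encode soct_instances"
proof (rule inj_onI)
  fix x y assume x: "x \<in> soct_instances" and y: "y \<in> soct_instances"
    and eq: "soct_encode x = soct_encode y"
  obtain G T k n where xd: "x = (G, T, k)" "simple_graph G" "verts G = {..<n}" "T \<subseteq> {..<n}"
    using x by (cases x) (auto simp: soct_instances_def)
  obtain H T' k' n' where yd: "y = (H, T', k')" "simple_graph H" "verts H = {..<n'}" "T' \<subseteq> {..<n'}"
    using y by (cases y) (auto simp: soct_instances_def)
  let ?r = "\<lambda>G i. map (\<lambda>j. of_bool ({i, j} \<in> edges G) :: nat) [0..<n]"
  have n: "n' = n" and k: "k' = k"
    using eq by (auto simp: soct_encode_def Let_def xd yd)
  have T: "map (\<lambda>i. of_bool (i \<in> T) :: nat) [0..<n] = map (\<lambda>i. of_bool (i \<in> T')) [0..<n]"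
    and C: "concat (map (?r G) [0..<n]) = concat (map (?r H) [0..<n])"
    using eq by (simp_all add: soct_encode_def xd yd n del: map_eq_conv)
  from C have "map (?r G) [0..<n] = map (?r H) [0..<n]"
    by (rule concat_injective) (auto simp: set_zip)
  then have E: "{i, j} \<in> edges G \<longleftrightarrow> {i, j} \<in> edges H" if "i < n" "j < n" for i j
    using that by (auto simp: of_bool_eq_iff)
  have sub: "edges A \<subseteq> edges B"
    if a: "simple_graph A" "verts A = {..<n}"
      "\<And>i j. i < n \<Longrightarrow> j < n \<Longrightarrow> {i, j} \<in> edges A \<longleftrightarrow> {i, j} \<in> edges B" for A B :: "nat graph"
  proof
    fix e assume e: "e \<in> edges A"
    then obtain u v where "e = {u, v}"
      using a(1) by (auto simp: simple_graph_def card_2_iff)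
    moreover have "e \<subseteq> {..<n}"
      using e a(1,2) by (auto simp: simple_graph_def)
    ultimately show "e \<in> edges B"
      using e a(3) by auto
  qed
  have "edges G = edges H"
    using sub[of G H] sub[of H G] xd yd n E by auto
  moreover have "T = T'"
    using T xd(4) yd(4) n by (auto simp: of_bool_eq_iff)
  ultimately show "x = y"
    using xd yd n k by simp
qed

end

theory Submission
  imports Defs
begin

text \<open>
  A \<open>P4\<close>-free graph with at least two vertices has a pair of twins, so it can be shrunk to a single
  vertex by repeatedly merging a twin \<open>v\<close> into its twin \<open>u\<close>. At each moment every remaining vertex
  stands for a module of the graph, for which we know the largest size of (a) an independent set,
  (b) a set in which no edge meets \<open>T\<close>, (g) a set containing no odd \<open>T\<close>-cycle, (t) a set disjoint
  from \<open>T\<close>. Merging non-adjacent twins adds these values. Merging adjacent twins forms a join, in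
  which an odd-\<open>T\<close>-cycle-free set that meets both sides and \<open>T\<close> is either a union of two independent
  sets, or a single vertex outside \<open>T\<close> together with a set of type (b): an edge in one side
  otherwise yields a triangle or a 5-cycle through \<open>T\<close>. The minimum transversal is the complement
  of a maximum set of type (g).

  The algorithm is written in a small language of bounded loops, whose compilation to random
  access machines preserves the semantics with polynomial overhead.
\<close>

section \<open>Twins in \<open>P4\<close>-free graphs\<close>

text \<open>\<open>E\<close> is an arbitrary relation instead of the edges of a graph, so that the
  statements below can be applied to the complement as well.\<close>

definition has_P4 :: "('a \<Rightarrow> 'a \<Rightarrow> bool) \<Rightarrow> 'a set \<Rightarrow> bool" where
  "has_P4 E A \<longleftrightarrow> (\<exists>a\<in>A. \<exists>b\<in>A. \<exists>c\<in>A. \<exists>d\<in>A. distinct [a, b, c, d] \<and>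
     E a b \<and> E b c \<and> E c d \<and> \<not> E a c \<and> \<not> E b d \<and> \<not> E a d)"

text \<open>For symmetric \<open>E\<close>, the value \<open>False\<close> means that the graph on
  \<open>V\<close> is disconnected, \<open>True\<close> that its complement is.\<close>

definition homogeneous_cut :: "('a \<Rightarrow> 'a \<Rightarrow> bool) \<Rightarrow> 'a set \<Rightarrow> 'a set \<Rightarrow> bool \<Rightarrow> bool" where
  "homogeneous_cut E V A b \<longleftrightarrow> A \<subset> V \<and> A \<noteq> {} \<and> (\<forall>x\<in>A. \<forall>y\<in>V - A. E x y = b)"

lemma has_P4_mono: "has_P4 E A \<Longrightarrow> A \<subseteq> B \<Longrightarrow> has_P4 E B"
  unfolding has_P4_def by blast

text \<open>If \<open>v\<close> is adjacent to all of \<open>V\<close>, then \<open>{v}\<close> is a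
  cut of the complement. Otherwise \<open>v\<close> misses a vertex on one of the two sides, and
  \<open>side\<close> finds a set with no edges leaving it.\<close>

lemma homogeneous_cut_extend:
  assumes sym: "\<And>x y. E x y = E y x" and no: "\<not> has_P4 E (insert v V)" and v: "v \<notin> V"
    and cut: "homogeneous_cut E V A False"
  shows "\<exists>A b. homogeneous_cut E (insert v V) A b"
proof -
  define B where "B = V - A"
  have A: "A \<noteq> {}" "B \<noteq> {}" "V = A \<union> B" "A \<inter> B = {}" "v \<notin> A" "v \<notin> B"
    "\<And>x y. x \<in> A \<Longrightarrow> y \<in> B \<Longrightarrow> \<not> E x y \<and> \<not> E y x"
    using cut v sym by (auto simp: homogeneous_cut_def B_def)
  \<comment> \<open>If a neighbour of \<open>v\<close> in \<open>C\<close> is adjacent to a non-neighbour of \<open>v\<close> in \<open>C\<close>, then a neighbour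
    of \<open>v\<close> in \<open>D\<close> would complete a \<open>P4\<close>; otherwise the non-neighbours in \<open>C\<close> are cut off.\<close>
  have side: "\<exists>A b. homogeneous_cut E (insert v V) A b"
    if s: "C \<noteq> {}" "D \<noteq> {}" "V = C \<union> D" "C \<inter> D = {}" "v \<notin> C" "v \<notin> D"
      "\<And>x y. x \<in> C \<Longrightarrow> y \<in> D \<Longrightarrow> \<not> E x y \<and> \<not> E y x" "x \<in> C" "\<not> E v x" for C D x
  proof (cases "\<exists>a\<in>C. \<exists>b\<in>C. E v a \<and> \<not> E v b \<and> E a b")
    case True
    then obtain a b where ab: "a \<in> C" "b \<in> C" "E v a" "\<not> E v b" "E a b" by blast
    have "\<not> E v d" if "d \<in> D" for d
    proof
      assume "E v d"
      moreover have "distinct [b, a, v, d]"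
        using s ab that by auto
      ultimately have "has_P4 E (insert v V)"
        unfolding has_P4_def using s(3) s(7)[of a d] s(7)[of b d] ab that sym
        by (intro bexI[of _ b] bexI[of _ a] bexI[of _ v] bexI[of _ d]) auto
      with no show False by blast
    qed
    then have "homogeneous_cut E (insert v V) D False"
      using s(1-6) s(7) sym[of v] sym unfolding homogeneous_cut_def by blast
    then show ?thesis by blast
  next
    case False
    have "\<not> E y z" if y: "y \<in> C" "\<not> E v y" and z: "z \<in> insert v V - {y \<in> C. \<not> E v y}" for y z
    proof -
      consider "z = v" | "z \<in> C" "E v z" | "z \<in> D"
        using z s(3) by blast
      then show ?thesis
        using y s(7) False sym[of y z] by cases blast+
    qed
    then have "homogeneous_cut E (insert v V) {y \<in> C. \<not> E v y} False"
      using s(3,5,8,9) unfolding homogeneous_cut_def by blast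
    then show ?thesis by blast
  qed
  show ?thesis
  proof (cases "\<exists>x\<in>V. \<not> E v x")
    case True
    then show ?thesis
      using side[of A B] side[of B A] A by blast
  next
    case False
    then have "homogeneous_cut E (insert v V) {v} True"
      using v A by (auto simp: homogeneous_cut_def)
    then show ?thesis by blast
  qed
qed

text \<open>This is Seinsche's theorem on \<open>P4\<close>-free graphs, by adding one vertex at a
  time. Since the complement of a \<open>P4\<close> is again a \<open>P4\<close>, a cut with value
  \<open>True\<close> is handled by passing to the complement.\<close>

lemma P4_free_homogeneous_cut:
  assumes "finite V" "card V \<ge> 2" "\<And>x y. E x y = E y x" "\<not> has_P4 E V"
  shows "\<exists>A b. homogeneous_cut E V A b"
  using assms
proof (induction V rule: finite_induct)
  case (insert v V)
  show ?case
  proof (cases "card V \<ge> 2")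
    case True
    then obtain A b where A: "homogeneous_cut E V A b"
      using insert has_P4_mono[of E V "insert v V"] by blast
    show ?thesis
    proof (cases b)
      case False
      then show ?thesis
        using homogeneous_cut_extend[OF insert.prems(2,3) insert.hyps(2)] A by simp
    next
      case True
      let ?E = "\<lambda>x y. x \<noteq> y \<and> \<not> E x y"
      \<comment> \<open>The complement of the \<open>P4\<close> \<open>a b c d\<close> is the \<open>P4\<close> \<open>b d a c\<close>.\<close>
      have "\<not> has_P4 ?E (insert v V)"
      proof
        assume "has_P4 ?E (insert v V)"
        then obtain a b c d where "a \<in> insert v V" "b \<in> insert v V" "c \<in> insert v V"
          "d \<in> insert v V" "distinct [a, b, c, d]" "?E a b" "?E b c" "?E c d"
          "\<not> ?E a c" "\<not> ?E b d" "\<not> ?E a d"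
          unfolding has_P4_def by blast
        then have "has_P4 E (insert v V)"
          unfolding has_P4_def using insert.prems(2)
          by (intro bexI[of _ b] bexI[of _ d] bexI[of _ a] bexI[of _ c]) auto
        with insert.prems show False by blast
      qed
      moreover have "homogeneous_cut ?E V A False"
        using A True by (auto simp: homogeneous_cut_def)
      ultimately obtain B c where B: "homogeneous_cut ?E (insert v V) B c"
        using homogeneous_cut_extend[of ?E v V A] insert.prems(2) insert.hyps by blast
      have "E x y = (\<not> c)" if "x \<in> B" "y \<in> insert v V - B" for x y
      proof -
        have "?E x y = c"
          using B that unfolding homogeneous_cut_def by blast
        then show ?thesis
          using that by blast
      qed
      then have "homogeneous_cut E (insert v V) B (\<not> c)"
        using B unfolding homogeneous_cut_def by blast
      then show ?thesis by blast
    qed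
  next
    case False
    then have "card V = 1"
      using insert by simp
    then obtain w where "V = {w}"
      by (auto simp: card_1_singleton_iff)
    then have "homogeneous_cut E (insert v V) {v} (E v w)"
      using insert.hyps by (auto simp: homogeneous_cut_def)
    then show ?thesis by blast
  qed
qed simp

definition twins :: "('a \<Rightarrow> 'a \<Rightarrow> bool) \<Rightarrow> 'a set \<Rightarrow> 'a \<Rightarrow> 'a \<Rightarrow> bool" where
  "twins E V u v \<longleftrightarrow> u \<in> V \<and> v \<in> V \<and> u \<noteq> v \<and> (\<forall>w\<in>V - {u, v}. E u w = E v w)"

text \<open>Every vertex outside a side of a homogeneous cut sees that side uniformly, so twins
  found inside the side by induction remain twins in \<open>V\<close>. If both sides are singletons,
  their two vertices are twins vacuously.\<close>

lemma P4_free_twins: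
  assumes "finite V" "card V \<ge> 2" "\<And>x y. E x y = E y x" "\<not> has_P4 E V"
  shows "\<exists>u v. twins E V u v"
  using assms
proof (induction V rule: finite_psubset_induct)
  case (psubset V)
  obtain A b where A: "homogeneous_cut E V A b"
    using P4_free_homogeneous_cut[of V E] psubset by blast
  have IH: "\<exists>u v. twins E V u v"
    if C: "C \<subset> V" "card C \<ge> 2" "\<forall>x\<in>C. \<forall>y\<in>V - C. E x y = b" for C
  proof -
    have "\<not> has_P4 E C"
      using psubset.prems(3) C(1) has_P4_mono[of E C V] by blast
    from psubset.IH[OF C(1,2) psubset.prems(2) this] obtain u v where "twins E C u v"
      by blast
    then have "twins E V u v"
      using C(1,3) unfolding twins_def by blast
    then show ?thesis by blast
  qed
  show ?case
  proof (cases "card A \<ge> 2 \<or> card (V - A) \<ge> 2")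
    case True
    then show ?thesis
    proof
      assume "card A \<ge> 2"
      then show ?thesis
        using IH[of A] A unfolding homogeneous_cut_def by blast
    next
      assume "card (V - A) \<ge> 2"
      moreover have "V - A \<subset> V" "\<forall>x\<in>V - A. \<forall>y\<in>V - (V - A). E x y = b"
        using A psubset.prems(2) unfolding homogeneous_cut_def by blast+
      ultimately show ?thesis
        using IH[of "V - A"] by blast
    qed
  next
    case False
    have f: "finite A" "A \<noteq> {}" "V - A \<noteq> {}" "A \<subseteq> V"
      using A finite_subset[OF _ psubset.hyps] by (auto simp: homogeneous_cut_def)
    have "card A \<noteq> 0" "card (V - A) \<noteq> 0"
      using f psubset.hyps by auto
    then have "card A = 1" "card (V - A) = 1"
      using False by linarith+
    then obtain u v where "A = {u}" "V - A = {v}"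
      by (auto simp: card_1_singleton_iff)
    then have "twins E V u v"
      using f(4) by (auto simp: twins_def)
    then show ?thesis by blast
  qed
qed

section \<open>Sets without odd \<open>T\<close>-cycles in unions and joins\<close>

abbreviation adj :: "'a graph \<Rightarrow> 'a \<Rightarrow> 'a \<Rightarrow> bool" where
  "adj G x y \<equiv> {x, y} \<in> edges G"

lemma adj_commute: "adj G x y = adj G y x"
  by (simp add: insert_commute)

lemma adj_irrefl: "simple_graph G \<Longrightarrow> \<not> adj G x x"
  by (auto simp: simple_graph_def)

lemma adj_verts: "simple_graph G \<Longrightarrow> adj G x y \<Longrightarrow> x \<in> verts G \<and> y \<in> verts G"
  by (auto simp: simple_graph_def)

lemma free_of_P4:
  assumes G: "simple_graph G" and free: "free_of (path_graph 4) G" and A: "A \<subseteq> verts G"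
  shows "\<not> has_P4 (adj G) A"
proof
  assume "has_P4 (adj G) A"
  then obtain a b c d where p: "a \<in> A" "b \<in> A" "c \<in> A" "d \<in> A" "distinct [a, b, c, d]"
    "adj G a b" "adj G b c" "adj G c d" "\<not> adj G a c" "\<not> adj G b d" "\<not> adj G a d"
    unfolding has_P4_def by blast
  let ?U = "{a, b, c, d}"
  \<comment> \<open>\<open>a\<close> is sent to the default value \<open>0\<close>, so the vertices
    are numbered along the path.\<close>
  let ?f = "(\<lambda>_. 0 :: nat)(b := 1, c := 2, d := 3)"
  have P: "{i, j} \<in> edges (path_graph 4) \<longleftrightarrow> j = Suc i \<and> Suc i < 4 \<or> i = Suc j \<and> Suc j < 4" for i j
    by (auto simp: path_graph_def doubleton_eq_iff)
  have "{..<4} = {0, 1, 2, 3 :: nat}" by auto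
  then have "bij_betw ?f ?U (verts (path_graph 4))"
    using p(5) by (auto simp: bij_betw_def inj_on_def path_graph_def)
  moreover have "\<forall>u\<in>?U. \<forall>v\<in>?U. {u, v} \<in> edges (induced_subgraph G ?U) \<longleftrightarrow>
      {?f u, ?f v} \<in> edges (path_graph 4)"
    using p(5-) adj_irrefl[OF G] unfolding P
    by (auto simp: induced_subgraph_def adj_commute)
  ultimately have "isomorphic (induced_subgraph G ?U) (path_graph 4)"
    unfolding isomorphic_def by (intro exI[of _ ?f]) (simp add: induced_subgraph_def)
  moreover have "?U \<subseteq> verts G"
    using p A by auto
  ultimately show False
    using free unfolding free_of_def by blast
qed

section \<open>Conditions that exclude odd \<open>T\<close>-cycles\<close>

definition no_odd_T_cycle :: "'a graph \<Rightarrow> 'a set \<Rightarrow> 'a set \<Rightarrow> bool" where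
  "no_odd_T_cycle G T F \<longleftrightarrow> (\<forall>c. odd_T_cycle G T c \<longrightarrow> \<not> set c \<subseteq> F)"

definition indep :: "'a graph \<Rightarrow> 'a set \<Rightarrow> bool" where
  "indep G F \<longleftrightarrow> (\<forall>x\<in>F. \<forall>y\<in>F. \<not> adj G x y)"

definition T_isolated :: "'a graph \<Rightarrow> 'a set \<Rightarrow> 'a set \<Rightarrow> bool" where
  "T_isolated G T F \<longleftrightarrow> (\<forall>x\<in>F \<inter> T. \<forall>y\<in>F. \<not> adj G x y)"

lemma is_cycle_adj:
  assumes "is_cycle G c" "i < length c"
  shows "adj G (c ! i) (c ! (Suc i mod length c))"
proof (cases "Suc i = length c")
  case True
  then have "last c = c ! i" "hd c = c ! 0"
    using assms(2) last_conv_nth[of c] hd_conv_nth[of c] diff_Suc_1[of i] by (fastforce simp flip: True)+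
  then show ?thesis
    using assms True by (simp add: is_cycle_def)
next
  case False
  then show ?thesis
    using assms by (simp add: is_cycle_def)
qed

text \<open>The successor and the predecessor on the cycle serve as witnesses; they differ because a
  cycle has at least three vertices.\<close>

lemma is_cycle_two_neighbours:
  assumes c: "is_cycle G c" and x: "x \<in> set c"
  shows "\<exists>y\<in>set c. \<exists>z\<in>set c. y \<noteq> z \<and> adj G x y \<and> adj G x z"
proof -
  let ?n = "length c"
  obtain i where i: "i < ?n" "x = c ! i"
    using x by (auto simp: in_set_conv_nth)
  have n: "?n \<ge> 3" "distinct c"
    using c by (auto simp: is_cycle_def)
  let ?j = "Suc i mod ?n" and ?k = "if i = 0 then ?n - 1 else i - 1"
  have jk: "?j < ?n" "?k < ?n" "Suc ?k mod ?n = i" "?j \<noteq> ?k"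
    using n(1) i(1) by (auto simp: mod_Suc split: if_splits)
  have "adj G x (c ! ?j)" "adj G x (c ! ?k)"
    using is_cycle_adj[OF c i(1)] is_cycle_adj[OF c jk(2)] jk(3) i(2) adj_commute by metis+
  moreover have "c ! ?j \<noteq> c ! ?k"
    using jk n(2) nth_eq_iff_index_eq by blast
  ultimately show ?thesis
    using jk(1,2) nth_mem by blast
qed

lemma no_odd_T_cycle_disjoint: "F \<inter> T = {} \<Longrightarrow> no_odd_T_cycle G T F"
  by (auto simp: no_odd_T_cycle_def odd_T_cycle_def)

text \<open>Membership in \<open>A\<close> alternates along the cycle: two consecutive vertices
  cannot both be in \<open>A\<close>, nor both outside it, since they would then both be in
  \<open>B\<close>. Alternation fails at the closing edge when the length is odd.\<close>

lemma no_odd_T_cycle_Un_indep: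
  assumes "indep G A" "indep G B"
  shows "no_odd_T_cycle G T (A \<union> B)"
  unfolding no_odd_T_cycle_def
proof (intro allI impI notI)
  fix c assume c: "odd_T_cycle G T c" "set c \<subseteq> A \<union> B"
  then have cyc: "is_cycle G c" and o: "odd (length c)" and n: "length c \<ge> 3"
    by (auto simp: odd_T_cycle_def is_cycle_def)
  have alt: "c ! (Suc i mod length c) \<in> A \<longleftrightarrow> c ! i \<notin> A" if "i < length c" for i
  proof -
    have "c ! i \<in> A \<union> B" "c ! (Suc i mod length c) \<in> A \<union> B"
      using that by (auto intro!: subsetD[OF c(2) nth_mem] mod_less_divisor simp del: Un_iff)
    then show ?thesis
      using is_cycle_adj[OF cyc that] assms unfolding indep_def by blast
  qed
  have "i < length c \<Longrightarrow> c ! i \<in> A \<longleftrightarrow> (c ! 0 \<in> A \<longleftrightarrow> even i)" for i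
  proof (induction i)
    case (Suc i)
    then show ?case using alt[of i] by simp
  qed simp
  moreover have "length c - 1 < length c" "Suc (length c - 1) = length c" "even (length c - 1)"
    using o n by auto
  ultimately show False
    using alt[of "length c - 1"] by simp
qed

text \<open>A vertex of \<open>T\<close> on the cycle lies in \<open>B\<close> and has no neighbour
  in \<open>B\<close>, so its two neighbours on the cycle both lie in \<open>A\<close>, which has
  room for only one.\<close>

lemma T_isolated_imp_no_odd_T_cycle:
  assumes B: "T_isolated G T B" and A: "A \<inter> T = {}" "finite A" "card A \<le> 1"
  shows "no_odd_T_cycle G T (A \<union> B)"
  unfolding no_odd_T_cycle_def
proof (intro allI impI notI)
  fix c assume c: "odd_T_cycle G T c" "set c \<subseteq> A \<union> B"
  then obtain t where t: "t \<in> set c" "t \<in> T" and cyc: "is_cycle G c"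
    by (auto simp: odd_T_cycle_def)
  obtain y z where yz: "y \<in> set c" "z \<in> set c" "y \<noteq> z" "adj G t y" "adj G t z"
    using is_cycle_two_neighbours[OF cyc t(1)] by blast
  then have "y \<in> A" "z \<in> A"
    using B A(1) t c(2) unfolding T_isolated_def by blast+
  then have "card {y, z} \<le> card A"
    using A by (intro card_mono) auto
  with A yz show False by simp
qed

lemma triangle_is_cycle:
  assumes "simple_graph G" "adj G x y" "adj G y z" "adj G x z"
  shows "is_cycle G [x, y, z]"
  using assms adj_irrefl[OF assms(1)] adj_verts[OF assms(1)]
  by (auto simp: is_cycle_def less_Suc_eq adj_commute nth_Cons split: nat.splits)

lemma pentagon_is_cycle:
  assumes "simple_graph G" "adj G a b" "adj G b c" "adj G c d" "adj G d e" "adj G e a"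
    "distinct [a, b, c, d, e]"
  shows "is_cycle G [a, b, c, d, e]"
  using assms adj_verts[OF assms(1)]
  by (auto simp: is_cycle_def less_Suc_eq nth_Cons split: nat.splits)

definition completely_adjacent :: "'a graph \<Rightarrow> 'a set \<Rightarrow> 'a set \<Rightarrow> bool" where
  "completely_adjacent G A B \<longleftrightarrow> (\<forall>x\<in>A. \<forall>y\<in>B. adj G x y)"

definition nowhere_adjacent :: "'a graph \<Rightarrow> 'a set \<Rightarrow> 'a set \<Rightarrow> bool" where
  "nowhere_adjacent G A B \<longleftrightarrow> (\<forall>x\<in>A. \<forall>y\<in>B. \<not> adj G x y)"

lemma nowhere_adjacent_commute: "nowhere_adjacent G A B = nowhere_adjacent G B A"
  unfolding nowhere_adjacent_def by (subst adj_commute) blast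

lemma no_odd_T_cycle_mono: "no_odd_T_cycle G T F \<Longrightarrow> F' \<subseteq> F \<Longrightarrow> no_odd_T_cycle G T F'"
  by (auto simp: no_odd_T_cycle_def)

text \<open>An edge of \<open>A\<close> forms a triangle with every vertex of \<open>B\<close>.
  Hence \<open>B\<close> and both ends of every edge in \<open>A\<close> avoid \<open>T\<close>, and
  the required vertex \<open>t\<close> of \<open>T\<close> lies in \<open>A\<close>. A second vertex
  of \<open>B\<close> would then give a 5-cycle through \<open>t\<close>.\<close>

lemma join_edge_side:
  assumes G: "simple_graph G" and AB: "completely_adjacent G A B"
    and no: "no_odd_T_cycle G T (A \<union> B)" and fin: "finite B" and B: "B \<noteq> {}"
    and A: "\<not> indep G A" and T: "(A \<union> B) \<inter> T \<noteq> {}"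
  shows "B \<inter> T = {}" "card B = 1" "T_isolated G T A"
proof -
  obtain x y where xy: "x \<in> A" "y \<in> A" "adj G x y"
    using A by (auto simp: indep_def)
  have tri: "T \<inter> {a, b, v} = {}" if "a \<in> A" "b \<in> A" "adj G a b" "v \<in> B" for a b v
  proof -
    have "is_cycle G [a, b, v]"
      using that AB G by (intro triangle_is_cycle) (auto simp: completely_adjacent_def)
    moreover have "set [a, b, v] \<subseteq> A \<union> B"
      using that by auto
    ultimately have "\<not> odd_T_cycle G T [a, b, v]"
      using no unfolding no_odd_T_cycle_def by blast
    then show ?thesis
      using \<open>is_cycle G [a, b, v]\<close> by (auto simp: odd_T_cycle_def)
  qed
  obtain v where v: "v \<in> B" using B by blast
  show BT: "B \<inter> T = {}"
    using tri[OF xy] by blast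
  show "T_isolated G T A"
    unfolding T_isolated_def using tri v by blast
  obtain t where t: "t \<in> A" "t \<in> T"
    using T BT by blast
  have "w = v" if w: "w \<in> B" for w
  proof (rule ccontr)
    assume "w \<noteq> v"
    have "t \<noteq> x" "t \<noteq> y"
      using tri[OF xy v] t by auto
    moreover have "A \<inter> B = {}"
      using AB adj_irrefl[OF G] unfolding completely_adjacent_def by blast
    ultimately have d: "distinct [t, v, x, y, w]"
      using t v w xy \<open>w \<noteq> v\<close> adj_irrefl[OF G] by auto
    \<comment> \<open>Four edges of this 5-cycle run between \<open>A\<close> and \<open>B\<close>;
      the fifth is the edge \<open>x y\<close> inside \<open>A\<close>.\<close>
    have "is_cycle G [t, v, x, y, w]"
      using d t v w xy AB unfolding completely_adjacent_def
      by (intro pentagon_is_cycle G) (auto simp: adj_commute)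
    then have "odd_T_cycle G T [t, v, x, y, w]"
      using t by (simp add: odd_T_cycle_def)
    moreover have "set [t, v, x, y, w] \<subseteq> A \<union> B"
      using t v w xy by simp
    ultimately show False
      using no unfolding no_odd_T_cycle_def by blast
  qed
  then have "B = {v}" using v by blast
  then show "card B = 1" by simp
qed

section \<open>Maximum sizes under union and join\<close>

definition is_max :: "('a set \<Rightarrow> bool) \<Rightarrow> 'a set \<Rightarrow> nat \<Rightarrow> bool" where
  "is_max Q M a \<longleftrightarrow> (\<exists>F\<subseteq>M. Q F \<and> card F = a) \<and> (\<forall>F\<subseteq>M. Q F \<longrightarrow> card F \<le> a)"

lemma is_max_Un:
  assumes M: "is_max Q A a" "is_max Q B b" "finite A" "finite B" "A \<inter> B = {}"
    and Q: "\<And>C D. C \<subseteq> A \<Longrightarrow> D \<subseteq> B \<Longrightarrow> Q (C \<union> D) \<longleftrightarrow> Q C \<and> Q D"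
  shows "is_max Q (A \<union> B) (a + b)"
  unfolding is_max_def
proof (intro conjI allI impI)
  obtain C D where CD: "C \<subseteq> A" "Q C" "card C = a" "D \<subseteq> B" "Q D" "card D = b"
    using M(1,2) by (auto simp: is_max_def)
  have "finite C" "finite D" "C \<inter> D = {}"
    using CD(1,4) M(3-5) finite_subset by auto
  then have "card (C \<union> D) = a + b"
    using CD by (simp add: card_Un_disjoint)
  then show "\<exists>F\<subseteq>A \<union> B. Q F \<and> card F = a + b"
    using CD Q[of C D] by (intro exI[of _ "C \<union> D"]) auto
next
  fix F assume F: "F \<subseteq> A \<union> B" "Q F"
  have e: "(F \<inter> A) \<union> (F \<inter> B) = F"
    using F by auto
  have "Q (F \<inter> A)" "Q (F \<inter> B)"
    using Q[of "F \<inter> A" "F \<inter> B"] F(2) unfolding e by auto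
  then have "card (F \<inter> A) \<le> a" "card (F \<inter> B) \<le> b"
    using M(1,2) by (auto simp: is_max_def)
  moreover have "card F \<le> card (F \<inter> A) + card (F \<inter> B)"
    using card_Un_le[of "F \<inter> A" "F \<inter> B"] unfolding e by simp
  ultimately show "card F \<le> a + b" by simp
qed

text \<open>The last value is \<open>card (M - T)\<close>, put in the same form as the others.\<close>

definition opt_values :: "'a graph \<Rightarrow> 'a set \<Rightarrow> 'a set \<Rightarrow> nat \<Rightarrow> nat \<Rightarrow> nat \<Rightarrow> nat \<Rightarrow> bool" where
  "opt_values G T M a b g t \<longleftrightarrow> is_max (indep G) M a \<and> is_max (T_isolated G T) M b \<and>
     is_max (no_odd_T_cycle G T) M g \<and> is_max (\<lambda>F. F \<inter> T = {}) M t"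

text \<open>There is no edge on which a cycle could leave the side containing its first
  vertex.\<close>

lemma no_odd_T_cycle_Un_iff:
  assumes "nowhere_adjacent G A B"
  shows "no_odd_T_cycle G T (A \<union> B) \<longleftrightarrow> no_odd_T_cycle G T A \<and> no_odd_T_cycle G T B"
proof (intro iffI conjI)
  assume *: "no_odd_T_cycle G T A \<and> no_odd_T_cycle G T B"
  show "no_odd_T_cycle G T (A \<union> B)"
    unfolding no_odd_T_cycle_def
  proof (intro allI impI notI)
    fix c assume c: "odd_T_cycle G T c" "set c \<subseteq> A \<union> B"
    then have cyc: "is_cycle G c" and n: "length c \<ge> 3"
      by (auto simp: odd_T_cycle_def is_cycle_def)
    have stay: "set c \<subseteq> D" if D: "c ! 0 \<in> D" "nowhere_adjacent G D D'" "set c \<subseteq> D \<union> D'" for D D'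
    proof -
      have "i < length c \<Longrightarrow> c ! i \<in> D" for i
      proof (induction i)
        case (Suc i)
        have "adj G (c ! i) (c ! Suc i)"
          using cyc Suc.prems by (simp add: is_cycle_def)
        moreover have "c ! Suc i \<in> D \<union> D'"
          using D(3) Suc.prems nth_mem by blast
        ultimately show ?case
          using Suc D(2) by (auto simp: nowhere_adjacent_def)
      qed (use D in simp)
      then show ?thesis
        by (auto simp: in_set_conv_nth)
    qed
    have "c ! 0 \<in> A \<union> B"
      using n by (intro subsetD[OF c(2)] nth_mem) linarith
    then have "set c \<subseteq> A \<or> set c \<subseteq> B"
      using stay[of A B] stay[of B A] assms c(2) nowhere_adjacent_commute[of G A B]
      by (auto simp: Un_commute)
    then show False
      using * c(1) unfolding no_odd_T_cycle_def by blast
  qed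
qed (auto intro: no_odd_T_cycle_mono)

lemma opt_values_union:
  assumes AB: "nowhere_adjacent G A B" "finite A" "finite B" "A \<inter> B = {}"
    and A: "opt_values G T A a b g t" and B: "opt_values G T B a' b' g' t'"
  shows "opt_values G T (A \<union> B) (a + a') (b + b') (g + g') (t + t')"
proof -
  have na: "nowhere_adjacent G C D" if "C \<subseteq> A" "D \<subseteq> B" for C D
    using AB(1) that unfolding nowhere_adjacent_def by blast
  have na': "\<not> adj G x y \<and> \<not> adj G y x" if "x \<in> A" "y \<in> B" for x y
    using AB(1) that unfolding nowhere_adjacent_def by (simp add: adj_commute)
  have "indep G (C \<union> D) \<longleftrightarrow> indep G C \<and> indep G D"
    "T_isolated G T (C \<union> D) \<longleftrightarrow> T_isolated G T C \<and> T_isolated G T D"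
    if "C \<subseteq> A" "D \<subseteq> B" for C D
    using na' that unfolding indep_def T_isolated_def by blast+
  with A B AB(2-) show ?thesis
    unfolding opt_values_def
    by (intro conjI is_max_Un no_odd_T_cycle_Un_iff na) auto
qed

text \<open>The maximum for \<open>no_odd_T_cycle\<close> lists all possible shapes: a set inside
  one side (\<open>g\<close>, \<open>g'\<close>), a set avoiding \<open>T\<close>
  (\<open>t + t'\<close>), two independent sets (\<open>a + a'\<close>), or one vertex outside
  \<open>T\<close> on one side and a \<open>T_isolated\<close> set on the other. The term
  \<open>min 1 t\<close> is \<open>0\<close> when the side has no vertex outside
  \<open>T\<close>.\<close>

lemma opt_values_join:
  assumes G: "simple_graph G"
    and AB: "completely_adjacent G A B" "finite A" "finite B" "A \<inter> B = {}"
    and A: "opt_values G T A a b g t" and B: "opt_values G T B a' b' g' t'"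
  shows "opt_values G T (A \<union> B) (max a a') (max (max b b') (t + t'))
    (max (max (max g g') (max (t + t') (a + a'))) (max (min 1 t + b') (min 1 t' + b))) (t + t')"
proof -
  have ach: "\<exists>F\<subseteq>A \<union> B. Q F \<and> card F = max x y"
    if "\<exists>F\<subseteq>A \<union> B. Q F \<and> card F = x" "\<exists>F\<subseteq>A \<union> B. Q F \<and> card F = y" for Q and x y :: nat
    using that by (simp add: max_def)
  have achA: "\<exists>F\<subseteq>A \<union> B. Q F \<and> card F = x" if "is_max Q A x" for Q x
    using that unfolding is_max_def by blast
  have achB: "\<exists>F\<subseteq>A \<union> B. Q F \<and> card F = x" if "is_max Q B x" for Q x
    using that unfolding is_max_def by blast
  have card: "card (C \<union> D) = card C + card D" if "C \<subseteq> A" "D \<subseteq> B" for C D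
    using that AB(2-) by (intro card_Un_disjoint) (auto intro: finite_subset)
  have split: "\<exists>C D. F = C \<union> D \<and> C \<subseteq> A \<and> D \<subseteq> B \<and> card F = card C + card D"
    if "F \<subseteq> A \<union> B" for F
    using that card[of "F \<inter> A" "F \<inter> B"]
    by (intro exI[of _ "F \<inter> A"] exI[of _ "F \<inter> B"]) (auto simp flip: Int_Un_distrib simp: Int_absorb2)
  obtain Ca Da where i: "Ca \<subseteq> A" "indep G Ca" "card Ca = a" "Da \<subseteq> B" "indep G Da" "card Da = a'"
    using A B by (auto simp: opt_values_def is_max_def)
  obtain Cb Db where b: "Cb \<subseteq> A" "T_isolated G T Cb" "card Cb = b"
      "Db \<subseteq> B" "T_isolated G T Db" "card Db = b'"
    using A B by (auto simp: opt_values_def is_max_def)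
  obtain Ct Dt where t: "Ct \<subseteq> A" "Ct \<inter> T = {}" "card Ct = t" "Dt \<subseteq> B" "Dt \<inter> T = {}" "card Dt = t'"
    using A B by (auto simp: opt_values_def is_max_def)
  \<comment> \<open>At most one vertex outside \<open>T\<close> is taken on each side; the set is
    empty if there is none.\<close>
  obtain C1 where C1: "C1 \<subseteq> Ct" "card C1 = min 1 t"
    using obtain_subset_with_card_n[of "min 1 t" Ct] t(3) by auto
  obtain D1 where D1: "D1 \<subseteq> Dt" "card D1 = min 1 t'"
    using obtain_subset_with_card_n[of "min 1 t'" Dt] t(6) by auto
  have fin: "finite C1" "finite D1"
    using C1(1) D1(1) t(1,4) AB(2,3) by (meson finite_subset)+
  have adj: "adj G x y \<and> adj G y x" if "x \<in> A" "y \<in> B" for x y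
    using AB(1) that unfolding completely_adjacent_def by (simp add: adj_commute)
  have le: "card C \<le> a \<and> card D \<le> a'" if "C \<subseteq> A" "D \<subseteq> B" "indep G C" "indep G D" for C D
    using A B that by (auto simp: opt_values_def is_max_def)
  have leb: "(T_isolated G T C \<longrightarrow> card C \<le> b) \<and> (T_isolated G T D \<longrightarrow> card D \<le> b')"
    if "C \<subseteq> A" "D \<subseteq> B" for C D
    using A B that by (auto simp: opt_values_def is_max_def)
  have leg: "(no_odd_T_cycle G T C \<longrightarrow> card C \<le> g) \<and> (no_odd_T_cycle G T D \<longrightarrow> card D \<le> g')"
    if "C \<subseteq> A" "D \<subseteq> B" for C D
    using A B that by (auto simp: opt_values_def is_max_def)
  have tle: "(C \<inter> T = {} \<longrightarrow> card C \<le> t) \<and> (D \<inter> T = {} \<longrightarrow> card D \<le> t')"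
    if "C \<subseteq> A" "D \<subseteq> B" for C D
    using A B that by (auto simp: opt_values_def is_max_def)
  have tau: "is_max (\<lambda>F. F \<inter> T = {}) (A \<union> B) (t + t')"
    using A B AB(2-) unfolding opt_values_def by (intro is_max_Un) auto
  have "is_max (indep G) (A \<union> B) (max a a')"
    unfolding is_max_def
  proof (intro conjI allI impI)
    show "\<exists>F\<subseteq>A \<union> B. indep G F \<and> card F = max a a'"
      using A B achA achB by (intro ach) (auto simp: opt_values_def)
    fix F assume "F \<subseteq> A \<union> B" "indep G F"
    then have "F \<subseteq> A \<or> F \<subseteq> B"
      using adj unfolding indep_def by blast
    then show "card F \<le> max a a'"
      using A B \<open>indep G F\<close> by (auto simp: opt_values_def is_max_def max.coboundedI1 max.coboundedI2)
  qed
  moreover have "is_max (T_isolated G T) (A \<union> B) (max (max b b') (t + t'))"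
    unfolding is_max_def
  proof (intro conjI allI impI)
    have "\<exists>F\<subseteq>A \<union> B. T_isolated G T F \<and> card F = t + t'"
      using tau unfolding is_max_def T_isolated_def by (metis empty_iff)
    then show "\<exists>F\<subseteq>A \<union> B. T_isolated G T F \<and> card F = max (max b b') (t + t')"
      using A B achA achB by (intro ach) (auto simp: opt_values_def)
    fix F assume F: "F \<subseteq> A \<union> B" "T_isolated G T F"
    \<comment> \<open>A vertex of \<open>T\<close> in \<open>F\<close> would be adjacent to all of
      \<open>F\<close> on the other side.\<close>
    then have "F \<subseteq> A \<or> F \<subseteq> B \<or> F \<inter> T = {}"
      using adj unfolding T_isolated_def by blast
    then show "card F \<le> max (max b b') (t + t')"
      using A B F tau by (auto simp: opt_values_def is_max_def max.coboundedI1 max.coboundedI2)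
  qed
  moreover have "is_max (no_odd_T_cycle G T) (A \<union> B)
    (max (max (max g g') (max (t + t') (a + a'))) (max (min 1 t + b') (min 1 t' + b)))"
    (is "is_max _ _ ?m")
    unfolding is_max_def
  proof (intro conjI allI impI)
    have "\<exists>F\<subseteq>A \<union> B. no_odd_T_cycle G T F \<and> card F = t + t'"
      using tau no_odd_T_cycle_disjoint unfolding is_max_def by metis
    moreover have "\<exists>F\<subseteq>A \<union> B. no_odd_T_cycle G T F \<and> card F = a + a'"
      using i card[of Ca Da] by (intro exI[of _ "Ca \<union> Da"]) (auto intro: no_odd_T_cycle_Un_indep)
    moreover have "\<exists>F\<subseteq>A \<union> B. no_odd_T_cycle G T F \<and> card F = min 1 t + b'"
      using b t(1,2) C1 fin card[of C1 Db]
      by (intro exI[of _ "C1 \<union> Db"]) (auto intro!: T_isolated_imp_no_odd_T_cycle)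
    moreover have "\<exists>F\<subseteq>A \<union> B. no_odd_T_cycle G T F \<and> card F = min 1 t' + b"
      using b t(4,5) D1 fin card[of Cb D1]
      by (intro exI[of _ "D1 \<union> Cb"]) (auto intro!: T_isolated_imp_no_odd_T_cycle simp: Un_commute[of Cb])
    ultimately show "\<exists>F\<subseteq>A \<union> B. no_odd_T_cycle G T F \<and> card F = ?m"
      using A B achA achB by (intro ach) (auto simp: opt_values_def)
    fix F assume F: "F \<subseteq> A \<union> B" "no_odd_T_cycle G T F"
    obtain C D where CD: "F = C \<union> D" "C \<subseteq> A" "D \<subseteq> B" "card F = card C + card D"
      using split[OF F(1)] by blast
    have fCD: "finite C" "finite D"
      using CD AB(2,3) finite_subset by auto
    have ca: "completely_adjacent G C D" "completely_adjacent G D C"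
      using CD(2,3) adj unfolding completely_adjacent_def by blast+
    \<comment> \<open>If none of the first four shapes applies, then one side contains an edge, and
      \<open>join_edge_side\<close> with that side as its \<open>A\<close> forces the other side to
      be a single vertex outside \<open>T\<close>.\<close>
    consider "D = {}" | "C = {}" | "F \<inter> T = {}" | "indep G C" "indep G D"
      | "C \<noteq> {}" "D \<noteq> {}" "F \<inter> T \<noteq> {}" "\<not> indep G C"
      | "C \<noteq> {}" "D \<noteq> {}" "F \<inter> T \<noteq> {}" "\<not> indep G D"
      by blast
    then show "card F \<le> ?m"
    proof cases
      case 5
      note e = join_edge_side[OF G ca(1) F(2)[unfolded CD(1)] fCD(2) 5(2,4) 5(3)[unfolded CD(1)]]
      have "card D \<le> min 1 t'" "card C \<le> b"
        using e tle[OF CD(2,3)] leb[OF CD(2,3)] by auto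
      then show ?thesis using CD(4) by linarith
    next
      case 6
      note e = join_edge_side[OF G ca(2) F(2)[unfolded CD(1) Un_commute[of C D]] fCD(1) 6(1,4)
          6(3)[unfolded CD(1) Un_commute[of C D]]]
      have "card C \<le> min 1 t" "card D \<le> b'"
        using e tle[OF CD(2,3)] leb[OF CD(2,3)] by auto
      then show ?thesis using CD(4) by linarith
    next
      case 1
      then show ?thesis using CD leg[OF CD(2,3)] F(2) by auto
    next
      case 2
      then show ?thesis using CD leg[OF CD(2,3)] F(2) by auto
    next
      case 3
      then have "card C \<le> t" "card D \<le> t'" using CD tle[OF CD(2,3)] by auto
      then show ?thesis using CD(4) by linarith
    next
      case 4
      then show ?thesis using CD le[OF CD(2,3)] by linarith
    qed
  qed
  ultimately show ?thesis
    using tau unfolding opt_values_def by blast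
qed

lemma opt_values_singleton:
  assumes G: "simple_graph G"
  shows "opt_values G T {u} 1 1 1 (1 - of_bool (u \<in> T))"
proof -
  have all: "is_max Q {u} 1" if "Q {u}" for Q
    unfolding is_max_def
  proof (intro conjI allI impI)
    show "\<exists>F\<subseteq>{u}. Q F \<and> card F = 1"
      using that by (intro exI[of _ "{u}"]) simp
    show "card F \<le> 1" if "F \<subseteq> {u}" for F
      using card_mono[OF _ that] by simp
  qed
  have "no_odd_T_cycle G T {u}"
    using T_isolated_imp_no_odd_T_cycle[of G T "{u}" "{}"] adj_irrefl[OF G]
    by (simp add: T_isolated_def)
  moreover have "is_max (\<lambda>F. F \<inter> T = {}) {u} (1 - of_bool (u \<in> T))"
  proof (cases "u \<in> T")
    case True
    have "card F = 0" if "F \<subseteq> {u}" "F \<inter> T = {}" for F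
    proof -
      have "F = {}" using that True by blast
      then show ?thesis by simp
    qed
    then show ?thesis
      using True unfolding is_max_def by (intro conjI exI[of _ "{}"] allI impI) simp_all
  qed (use all in simp)
  ultimately show ?thesis
    unfolding opt_values_def using adj_irrefl[OF G]
    by (intro conjI all) (simp_all add: indep_def T_isolated_def)
qed

text \<open>Transversals are exactly the complements of sets without odd \<open>T\<close>-cycles.
  Written as a sum, the condition avoids truncated subtraction.\<close>

lemma soct_yes_iff:
  assumes "finite (verts G)" and m: "is_max (no_odd_T_cycle G T) (verts G) g"
  shows "soct_yes (G, T, k) \<longleftrightarrow> card (verts G) \<le> k + g"
proof
  assume "soct_yes (G, T, k)"
  then obtain S where S: "odd_T_cycle_transversal G T S" "card S \<le> k"
    by (auto simp: soct_yes_def)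
  then have sub: "S \<subseteq> verts G"
    by (simp add: odd_T_cycle_transversal_def)
  have "no_odd_T_cycle G T (verts G - S)"
    using S(1) unfolding odd_T_cycle_transversal_def no_odd_T_cycle_def by blast
  then have "card (verts G - S) \<le> g"
    using m by (auto simp: is_max_def)
  moreover have "card (verts G - S) = card (verts G) - card S"
    using sub assms(1) by (intro card_Diff_subset finite_subset[OF sub])
  ultimately show "card (verts G) \<le> k + g"
    using S(2) by linarith
next
  assume *: "card (verts G) \<le> k + g"
  obtain F where F: "F \<subseteq> verts G" "no_odd_T_cycle G T F" "card F = g"
    using m by (auto simp: is_max_def)
  have "odd_T_cycle_transversal G T (verts G - F)"
    unfolding odd_T_cycle_transversal_def
  proof (intro conjI allI impI)
    fix c assume c: "odd_T_cycle G T c"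
    then have "\<not> set c \<subseteq> F" "set c \<subseteq> verts G"
      using F(2) by (auto simp: no_odd_T_cycle_def odd_T_cycle_def is_cycle_def)
    then show "set c \<inter> (verts G - F) \<noteq> {}" by blast
  qed simp
  moreover have "card (verts G - F) = card (verts G) - card F"
    using F(1) assms(1) by (intro card_Diff_subset finite_subset[OF F(1)])
  ultimately show "soct_yes (G, T, k)"
    using * F(3) unfolding soct_yes_def by auto
qed

section \<open>A language of bounded loops and its compilation\<close>

text \<open>\<open>Al\<close>, \<open>Be\<close>, \<open>Ga\<close>, \<open>Ta\<close> hold the values (a), (b), (g), (t) of the module of a vertex, and
  \<open>Row\<close> the position of its adjacency row in the input; scalars are entries \<open>0\<close> of arrays.\<close>

datatype var = Row | Off | Alive | Al | Be | Ga | Ta | U | V | W | I | Ok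

fun var_num :: "var \<Rightarrow> nat" where
  "var_num Row = 0" | "var_num Off = 1" | "var_num Alive = 2" | "var_num Al = 3"
| "var_num Be = 4" | "var_num Ga = 5" | "var_num Ta = 6" | "var_num U = 7"
| "var_num V = 8" | "var_num W = 9" | "var_num I = 10" | "var_num Ok = 11"

type_synonym state = "var \<Rightarrow> nat \<Rightarrow> nat"

datatype aexp = N nat | Arr var aexp | Inp aexp | Plus aexp aexp | Minus aexp aexp

text \<open>Every \<open>For\<close> loop runs over \<open>0, \<dots>, xs ! 0 - 1\<close>, where \<open>xs\<close> is the input. Hence every
  command terminates within a polynomial in \<open>xs ! 0\<close>.\<close>

datatype com = Skip | Assign var aexp aexp | Seq com com  (infixr \<open>;;\<close> 60)
  | Cond aexp com com | For var com

fun aval :: "nat list \<Rightarrow> aexp \<Rightarrow> state \<Rightarrow> nat" where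
  "aval xs (N c) s = c"
| "aval xs (Arr a e) s = s a (aval xs e s)"
| "aval xs (Inp e) s = (if aval xs e s < length xs then xs ! aval xs e s else 0)"
| "aval xs (Plus e f) s = aval xs e s + aval xs f s"
| "aval xs (Minus e f) s = aval xs e s - aval xs f s"

definition upd :: "state \<Rightarrow> var \<Rightarrow> nat \<Rightarrow> nat \<Rightarrow> state" where
  "upd s a i x = s(a := (s a)(i := x))"

fun sem :: "nat list \<Rightarrow> com \<Rightarrow> state \<Rightarrow> state" where
  "sem xs Skip s = s"
| "sem xs (Assign a e f) s = upd s a (aval xs e s) (aval xs f s)"
| "sem xs (c ;; d) s = sem xs d (sem xs c s)"
| "sem xs (Cond e c d) s = (if aval xs e s \<noteq> 0 then sem xs c s else sem xs d s)"
| "sem xs (For x c) s = fold (\<lambda>i s. sem xs c (upd s x 0 i)) [0..<xs ! 0] s"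

text \<open>The entry \<open>i\<close> of the array \<open>a\<close> lives in the odd register \<open>addr a i\<close>; the even registers
  are temporaries.\<close>

definition addr :: "var \<Rightarrow> nat \<Rightarrow> nat" where
  "addr a i = 32 * i + (2 * var_num a + 1)"

text \<open>Turns the index in register \<open>2 * d\<close> into a register number. Five doublings
  multiply by 32, as the machine has no multiplication; register \<open>2 * d + 2\<close> is
  scratch.\<close>

definition address_code :: "var \<Rightarrow> nat \<Rightarrow> instr list" where
  "address_code a d = replicate 5 (Add (2 * d) (2 * d) (2 * d)) @
     [Const (2 * d + 2) (2 * var_num a + 1), Add (2 * d) (2 * d) (2 * d + 2)]"

text \<open>The depth \<open>d\<close> acts as a stack pointer: the value is left in register
  \<open>2 * d\<close>, and the temporaries below it are kept.\<close>

fun comp_aexp :: "aexp \<Rightarrow> nat \<Rightarrow> instr list" where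
  "comp_aexp (N c) d = [Const (2 * d) c]"
| "comp_aexp (Arr a e) d = comp_aexp e d @ address_code a d @ [Load (2 * d) (2 * d)]"
| "comp_aexp (Inp e) d = comp_aexp e d @ [Read (2 * d) (2 * d)]"
| "comp_aexp (Plus e f) d = comp_aexp e d @ comp_aexp f (Suc d) @ [Add (2 * d) (2 * d) (2 * d + 2)]"
| "comp_aexp (Minus e f) d = comp_aexp e d @ comp_aexp f (Suc d) @ [Sub (2 * d) (2 * d) (2 * d + 2)]"

text \<open>The position \<open>p\<close> is passed along because jump targets are absolute. A loop
  keeps its counter in \<open>2 * d\<close> and its bound in \<open>2 * d + 2\<close>, hence its
  body is compiled at depth \<open>d + 2\<close>; \<open>x\<close> receives only a copy of the
  counter, so assignments in the body cannot affect the number of rounds.\<close>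

fun comp :: "com \<Rightarrow> nat \<Rightarrow> nat \<Rightarrow> instr list" where
  "comp Skip d p = []"
| "comp (Assign a e f) d p = comp_aexp e d @ address_code a d @
     comp_aexp f (Suc d) @ [Store (2 * d) (2 * d + 2)]"
| "comp (b ;; c) d p = (let B = comp b d p in B @ comp c d (p + length B))"
| "comp (Cond e b c) d p =
     (let E = comp_aexp e d; B = comp b d (p + length E + 1);
          q = p + length E + 1 + length B + 1; C = comp c d q
      in E @ [JumpZero (2 * d) q] @ B @ [Jump (q + length C)] @ C)"
| "comp (For x c) d p =
     (let C = comp c (d + 2) (p + 6) in
      [Const (2 * d) 0, Const (2 * d + 2) 0, Read (2 * d + 2) (2 * d + 2),
       Sub (2 * d + 4) (2 * d + 2) (2 * d), JumpZero (2 * d + 4) (p + 6 + length C + 3),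
       Copy (addr x 0) (2 * d)] @ C @
      [Const (2 * d + 4) 1, Add (2 * d) (2 * d) (2 * d + 4), Jump (p + 3)])"

section \<open>Correctness and running time of compiled code\<close>

lemma addr_eq_iff: "addr a i = addr b j \<longleftrightarrow> a = b \<and> i = j"
proof
  assume eq: "addr a i = addr b j"
  \<comment> \<open>As the array part stays below 32, division by 32 with remainder recovers both
    the array and the index.\<close>
  have b: "2 * var_num c + 1 < 32" for c
    by (cases c) simp_all
  have "addr c k mod 32 = 2 * var_num c + 1" "addr c k div 32 = k" for c k
    using b[of c] by (simp_all add: addr_def)
  then have "var_num a = var_num b" "i = j"
    using eq by (metis add_right_cancel mult_cancel_left zero_neq_numeral)+
  then show "a = b \<and> i = j"
    by (cases a; cases b; simp)
qed simp

lemma odd_addr: "odd (addr a i)"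
  by (simp add: addr_def)

lemma addr_neq_double: "addr a i \<noteq> 2 * d" "addr a i \<noteq> 2 * d + 2" "addr a i \<noteq> 2 * d + 4"
  "2 * d \<noteq> addr a i" "2 * d + 2 \<noteq> addr a i" "2 * d + 4 \<noteq> addr a i"
  unfolding addr_def by presburger+

definition rep :: "state \<Rightarrow> (nat \<Rightarrow> nat) \<Rightarrow> bool" where
  "rep s m \<longleftrightarrow> (\<forall>a i. m (addr a i) = s a i)"

fun code_at :: "instr list \<Rightarrow> nat \<Rightarrow> instr list \<Rightarrow> bool" where
  "code_at P p [] \<longleftrightarrow> True"
| "code_at P p (i # is) \<longleftrightarrow> p < length P \<and> P ! p = i \<and> code_at P (Suc p) is"

lemma code_at_append:
  "code_at P p (is @ js) \<longleftrightarrow> code_at P p is \<and> code_at P (p + length is) js"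
  by (induction "is" arbitrary: p) auto

lemma code_at_self: "code_at (pre @ is @ post) (length pre) is"
proof (induction "is" arbitrary: pre)
  case (Cons i "is")
  from Cons[of "pre @ [i]"] show ?case by simp
qed simp

definition reaches ::
  "instr list \<Rightarrow> nat list \<Rightarrow> nat \<Rightarrow> config \<Rightarrow> config \<Rightarrow> bool" where
  "reaches P xs b c c' \<longleftrightarrow> (\<exists>t\<le>b. (ram_step P xs ^^ t) c = c')"

lemma reaches_refl: "reaches P xs b c c"
  unfolding reaches_def by (intro exI[of _ 0]) simp

lemma reaches_trans:
  assumes "reaches P xs b c c'" "reaches P xs b' c' c''"
  shows "reaches P xs (b + b') c c''"
proof -
  obtain t t' where "t \<le> b" "t' \<le> b'" "(ram_step P xs ^^ t) c = c'" "(ram_step P xs ^^ t') c' = c''"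
    using assms by (auto simp: reaches_def)
  then show ?thesis
    unfolding reaches_def by (intro exI[of _ "t' + t"]) (simp add: funpow_add)
qed

lemma reaches_mono: "reaches P xs b c c' \<Longrightarrow> b \<le> b' \<Longrightarrow> reaches P xs b' c c'"
  unfolding reaches_def using order_trans by blast

lemma reaches_step:
  "p < length P \<Longrightarrow> P ! p = i \<Longrightarrow> reaches P xs 1 (p, m) (exec xs i (p, m))"
  unfolding reaches_def by (intro exI[of _ 1]) (simp add: ram_step_def halted_def)

fun straight :: "instr \<Rightarrow> bool" where
  "straight (Jump l) = False"
| "straight (JumpZero r l) = False"
| "straight _ = True"

definition effect :: "nat list \<Rightarrow> instr list \<Rightarrow> (nat \<Rightarrow> nat) \<Rightarrow> nat \<Rightarrow> nat" where
  "effect xs is = fold (\<lambda>i m. snd (exec xs i (0, m))) is"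

lemma effect_simps [simp]:
  "effect xs [] m = m"
  "effect xs (i # is) m = effect xs is (snd (exec xs i (0, m)))"
  "effect xs (is @ js) m = effect xs js (effect xs is m)"
  by (simp_all add: effect_def)

lemma reaches_straight:
  "code_at P p is \<Longrightarrow> list_all straight is \<Longrightarrow>
    reaches P xs (length is) (p, m) (p + length is, effect xs is m)"
proof (induction "is" arbitrary: p m)
  case (Cons i "is")
  have "exec xs i (p, m) = (Suc p, snd (exec xs i (0, m)))"
    using Cons.prems by (cases i) auto
  then have "reaches P xs 1 (p, m) (Suc p, snd (exec xs i (0, m)))"
    using reaches_step[of p P i xs m] Cons.prems by simp
  from reaches_trans[OF this Cons.IH] show ?case
    using Cons.prems by simp
qed (simp add: reaches_refl)

lemma straight_address_code [simp]: "list_all straight (address_code a d)"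
  by (simp add: address_code_def numeral_eq_Suc)

lemma effect_address_code [simp]:
  "effect xs (address_code a d) m =
    m(2 * d + 2 := 2 * var_num a + 1, 2 * d := addr a (m (2 * d)))"
proof -
  have "effect xs (replicate k (Add r r r)) m = m(r := 2 ^ k * m r)" for k r :: nat and m :: "nat \<Rightarrow> nat"
    by (induction k arbitrary: m) (simp_all add: fun_eq_iff)
  then show ?thesis
    by (simp add: address_code_def addr_def fun_eq_iff)
qed

lemma straight_comp_aexp: "list_all straight (comp_aexp e d)"
  by (induction e arbitrary: d) auto

text \<open>Only even registers from \<open>2 * d\<close> on are written. So the stored state
  survives, and in a binary operation the first operand survives the evaluation of the second at
  depth \<open>Suc d\<close>.\<close>

lemma effect_comp_aexp:
  assumes "rep s m"
  shows "effect xs (comp_aexp e d) m (2 * d) = aval xs e s \<and>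
    (\<forall>r. odd r \<or> r < 2 * d \<longrightarrow> effect xs (comp_aexp e d) m r = m r)"
  using assms
proof (induction e arbitrary: d m)
  case (Arr a e)
  have "effect xs (comp_aexp e d) m (addr a i) = s a i" for i
    using Arr odd_addr by (simp add: rep_def)
  then show ?case
    using Arr addr_neq_double by auto
next
  case (Plus e f)
  have "rep s (effect xs (comp_aexp e d) m)"
    using Plus.IH(1)[OF Plus.prems, of d] Plus.prems odd_addr by (simp add: rep_def)
  from Plus.IH(2)[OF this, of "Suc d"] Plus.IH(1)[OF Plus.prems, of d] show ?case
    by auto
next
  case (Minus e f)
  have "rep s (effect xs (comp_aexp e d) m)"
    using Minus.IH(1)[OF Minus.prems, of d] Minus.prems odd_addr by (simp add: rep_def)
  from Minus.IH(2)[OF this, of "Suc d"] Minus.IH(1)[OF Minus.prems, of d] show ?case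
    by auto
qed auto

lemma rep_upd:
  "rep s m \<Longrightarrow> (\<And>b j. m' (addr b j) = (if b = a \<and> j = i then x else m (addr b j))) \<Longrightarrow> rep (upd s a i x) m'"
  by (auto simp: rep_def upd_def)

text \<open>The bound depends on the input only through \<open>xs ! 0\<close>, and not on the state
  or the place of the code. Temporaries below \<open>d\<close> must be kept, since they hold the
  counters and bounds of enclosing loops.\<close>

definition simulates :: "com \<Rightarrow> nat \<Rightarrow> nat poly \<Rightarrow> bool" where
  "simulates c d q \<longleftrightarrow> (\<forall>xs P p s m. xs \<noteq> [] \<longrightarrow> code_at P p (comp c d p) \<longrightarrow> rep s m \<longrightarrow>
     (\<exists>m'. reaches P xs (poly q (xs ! 0)) (p, m) (p + length (comp c d p), m') \<and>
           rep (sem xs c s) m' \<and> (\<forall>r<d. m' (2 * r) = m (2 * r))))"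

lemma simulatesD:
  assumes "simulates c d q" "xs \<noteq> []" "code_at P p (comp c d p)" "rep s m"
  shows "\<exists>m'. reaches P xs (poly q (xs ! 0)) (p, m) (p + length (comp c d p), m') \<and>
    rep (sem xs c s) m' \<and> (\<forall>r<d. m' (2 * r) = m (2 * r))"
  using assms unfolding simulates_def by blast

text \<open>The polynomials add up along sequences and branches, and a loop multiplies the bound of
  its body by \<open>xs ! 0\<close>.\<close>

lemma comp_correct: "\<exists>q. simulates c d q"
proof (induction c arbitrary: d)
  case Skip
  show ?case by (auto simp: simulates_def intro: reaches_refl)
next
  case (Assign a e f)
  let ?E1 = "comp_aexp e d @ address_code a d"
  let ?C = "comp (Assign a e f) d 0"
  show ?case
    unfolding simulates_def
  proof (intro exI[of _ "[:length ?C:]"] allI impI)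
    fix xs :: "nat list" and P p s and m :: "nat \<Rightarrow> nat"
    assume *: "code_at P p (comp (Assign a e f) d p)" "rep s m"
    define m1 where "m1 = effect xs ?E1 m"
    define m2 where "m2 = effect xs (comp_aexp f (Suc d)) m1"
    let ?m3 = "m2(m2 (2 * d) := m2 (2 * d + 2))"
    have e: "effect xs ?C m = ?m3"
      by (simp add: m1_def m2_def del: effect_address_code)
    have m1: "m1 (2 * d) = addr a (aval xs e s)" "\<And>r. odd r \<or> r < 2 * d \<Longrightarrow> m1 r = m r"
      using effect_comp_aexp[OF *(2), of xs e d] by (auto simp: m1_def)
    then have "rep s m1"
      using *(2) odd_addr by (simp add: rep_def)
    from effect_comp_aexp[OF this, of xs f "Suc d"]
    have m2: "m2 (2 * d + 2) = aval xs f s" "\<And>r. odd r \<or> r < 2 * d + 2 \<Longrightarrow> m2 r = m1 r"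
      by (auto simp: m2_def)
    \<comment> \<open>The target address computed first is still in \<open>2 * d\<close>, because
      the value is evaluated one level higher.\<close>
    have "m2 (2 * d) = addr a (aval xs e s)"
      using m2(2)[of "2*d"] m1(1) by simp
    then have m3: "?m3 = m2(addr a (aval xs e s) := aval xs f s)"
      using m2(1) by simp
    have "rep (sem xs (Assign a e f) s) ?m3"
      unfolding sem.simps m3 using *(2)
      by (rule rep_upd) (use m2(2) m1(2) odd_addr addr_eq_iff in auto)
    moreover have "\<forall>r<d. ?m3 (2 * r) = m (2 * r)"
      unfolding m3 using m2(2) m1(2) addr_neq_double by simp
    moreover have "reaches P xs (length ?C) (p, m) (p + length ?C, effect xs ?C m)"
      by (rule reaches_straight) (use *(1) straight_comp_aexp in auto)
    ultimately show "\<exists>m'. reaches P xs (poly [:length ?C:] (xs ! 0)) (p, m)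
         (p + length (comp (Assign a e f) d p), m') \<and>
         rep (sem xs (Assign a e f) s) m' \<and> (\<forall>r<d. m' (2 * r) = m (2 * r))"
      unfolding e by (intro exI[of _ ?m3]) simp
  qed
next
  case (Seq b c)
  obtain q where "simulates b d q"
    using Seq.IH(1)[of d] by blast
  note q = simulatesD[OF this]
  obtain r where "simulates c d r"
    using Seq.IH(2)[of d] by blast
  note r = simulatesD[OF this]
  show ?case
    unfolding simulates_def
  proof (intro exI[of _ "q + r"] allI impI)
    fix xs :: "nat list" and P p s and m :: "nat \<Rightarrow> nat"
    assume *: "xs \<noteq> []" "code_at P p (comp (b ;; c) d p)" "rep s m"
    let ?p = "p + length (comp b d p)"
    have c: "code_at P p (comp b d p)" "code_at P ?p (comp c d ?p)"
      using *(2) by (auto simp: Let_def code_at_append)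
    obtain m1 where m1: "reaches P xs (poly q (xs ! 0)) (p, m) (?p, m1)"
      "rep (sem xs b s) m1" "\<forall>r<d. m1 (2 * r) = m (2 * r)"
      using q[OF *(1) c(1) *(3)] by blast
    obtain m2 where m2: "reaches P xs (poly r (xs ! 0)) (?p, m1) (?p + length (comp c d ?p), m2)"
      "rep (sem xs c (sem xs b s)) m2" "\<forall>r<d. m2 (2 * r) = m1 (2 * r)"
      using r[OF *(1) c(2) m1(2)] by blast
    show "\<exists>m'. reaches P xs (poly (q + r) (xs ! 0)) (p, m) (p + length (comp (b ;; c) d p), m') \<and>
         rep (sem xs (b ;; c) s) m' \<and> (\<forall>r<d. m' (2 * r) = m (2 * r))"
      using reaches_trans[OF m1(1) m2(1)] m2(2,3) m1(3)
      by (intro exI[of _ m2]) (simp add: Let_def add.assoc)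
  qed
next
  case (Cond e b c)
  obtain q where "simulates b d q"
    using Cond.IH(1)[of d] by blast
  note q = simulatesD[OF this]
  obtain r where "simulates c d r"
    using Cond.IH(2)[of d] by blast
  note r = simulatesD[OF this]
  let ?E = "comp_aexp e d"
  show ?case
    unfolding simulates_def
  \<comment> \<open>Two extra steps: the conditional jump after the test and the jump over the
    second branch. The sum \<open>q + r\<close> bounds whichever branch is taken.\<close>
  proof (intro exI[of _ "[:length ?E + 2:] + q + r"] allI impI)
    fix xs :: "nat list" and P p s and m :: "nat \<Rightarrow> nat"
    assume *: "xs \<noteq> []" "code_at P p (comp (Cond e b c) d p)" "rep s m"
    define p1 where "p1 = p + length ?E + 1"
    define p2 where "p2 = p1 + length (comp b d p1) + 1"
    define p3 where "p3 = p2 + length (comp c d p2)"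
    have c: "code_at P p ?E" "code_at P (p + length ?E) [JumpZero (2 * d) p2]"
      "code_at P p1 (comp b d p1)" "code_at P (p1 + length (comp b d p1)) [Jump p3]"
      "code_at P p2 (comp c d p2)" and p3: "p + length (comp (Cond e b c) d p) = p3"
      using *(2) by (auto simp: Let_def code_at_append p1_def p2_def p3_def)
    let ?m = "effect xs ?E m"
    have m: "?m (2 * d) = aval xs e s" "\<forall>r<d. ?m (2 * r) = m (2 * r)" "rep s ?m"
      using effect_comp_aexp[OF *(3), of xs e d] *(3) odd_addr by (auto simp: rep_def)
    have r0: "reaches P xs (length ?E) (p, m) (p + length ?E, ?m)"
      using c(1) straight_comp_aexp by (rule reaches_straight)
    have r1: "reaches P xs 1 (p + length ?E, ?m) (if aval xs e s \<noteq> 0 then p1 else p2, ?m)"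
      using reaches_step[of "p + length ?E" P "JumpZero (2 * d) p2" xs ?m] c(2) m(1)
      by (auto simp: p1_def split: if_splits)
    note r01 = reaches_trans[OF r0 r1]
    show "\<exists>m'. reaches P xs (poly ([:length ?E + 2:] + q + r) (xs ! 0)) (p, m)
         (p + length (comp (Cond e b c) d p), m') \<and>
         rep (sem xs (Cond e b c) s) m' \<and> (\<forall>r<d. m' (2 * r) = m (2 * r))"
    proof (cases "aval xs e s = 0")
      case True
      obtain m2 where m2: "reaches P xs (poly r (xs ! 0)) (p2, ?m) (p3, m2)"
        "rep (sem xs c s) m2" "\<forall>r<d. m2 (2 * r) = ?m (2 * r)"
        using r[OF *(1) c(5) m(3)] unfolding p3_def by blast
      have "reaches P xs (length ?E + 1 + poly r (xs ! 0)) (p, m) (p3, m2)"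
        using reaches_trans[OF r01, of "poly r (xs ! 0)" "(p3, m2)"] m2(1) True by simp
      then have "reaches P xs (poly ([:length ?E + 2:] + q + r) (xs ! 0)) (p, m) (p3, m2)"
        by (rule reaches_mono) simp
      then show ?thesis
        using m2 m(2) True unfolding p3 by auto
    next
      case False
      obtain m2 where m2: "reaches P xs (poly q (xs ! 0)) (p1, ?m) (p1 + length (comp b d p1), m2)"
        "rep (sem xs b s) m2" "\<forall>r<d. m2 (2 * r) = ?m (2 * r)"
        using q[OF *(1) c(3) m(3)] by blast
      have "reaches P xs (length ?E + 1 + poly q (xs ! 0)) (p, m) (p1 + length (comp b d p1), m2)"
        using reaches_trans[OF r01, of "poly q (xs ! 0)"] m2(1) False by simp
      moreover have "reaches P xs 1 (p1 + length (comp b d p1), m2) (p3, m2)"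
        using reaches_step[of "p1 + length (comp b d p1)" P "Jump p3" xs m2] c(4) by simp
      ultimately have "reaches P xs (length ?E + 1 + poly q (xs ! 0) + 1) (p, m) (p3, m2)"
        by (rule reaches_trans)
      then have "reaches P xs (poly ([:length ?E + 2:] + q + r) (xs ! 0)) (p, m) (p3, m2)"
        by (rule reaches_mono) simp
      then show ?thesis
        using m2 m(2) False unfolding p3 by auto
    qed
  qed
next
  case (For x c)
  obtain q where "simulates c (d + 2) q"
    using For.IH[of "d + 2"] by blast
  note q = simulatesD[OF this]
  show ?case
    unfolding simulates_def
  \<comment> \<open>Three steps set up the counter and the bound, two more detect the end. Each
    round costs the test, the copy of the counter, the body, the increment and the jump back: six
    steps besides \<open>q\<close>.\<close>
  proof (intro exI[of _ "[:5:] + [:0, 1:] * ([:6:] + q)"] allI impI)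
    fix xs :: "nat list" and P p s and m :: "nat \<Rightarrow> nat"
    assume *: "xs \<noteq> []" "code_at P p (comp (For x c) d p)" "rep s m"
    let ?C = "comp c (d + 2) (p + 6)"
    let ?n = "xs ! 0" and ?f = "\<lambda>i s. sem xs c (upd s x 0 i)"
    define p1 where "p1 = p + 6 + length ?C"
    have c: "code_at P p [Const (2 * d) 0, Const (2 * d + 2) 0, Read (2 * d + 2) (2 * d + 2)]"
       "code_at P (p + 3) [Sub (2 * d + 4) (2 * d + 2) (2 * d)]"
       "code_at P (p + 4) [JumpZero (2 * d + 4) (p1 + 3)]"
       "code_at P (p + 5) [Copy (addr x 0) (2 * d)]"
       "code_at P (p + 6) ?C"
       "code_at P p1 [Const (2 * d + 4) 1, Add (2 * d) (2 * d) (2 * d + 4)]"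
       "code_at P (p1 + 2) [Jump (p + 3)]"
       and p1: "p + length (comp (For x c) d p) = p1 + 3"
      using *(2) by (auto simp: Let_def code_at_append p1_def numeral_eq_Suc add.assoc)
    \<comment> \<open>Induction from \<open>?n\<close> downwards over the counter value
      \<open>j\<close> stored in \<open>2 * d\<close>; the bound sits in
      \<open>2 * d + 2\<close>.\<close>
    have loop: "\<exists>m'. reaches P xs (2 + (?n - j) * (6 + poly q ?n)) (p + 3, m) (p1 + 3, m') \<and>
        rep (fold ?f [j..<?n] s) m' \<and> (\<forall>r<d. m' (2 * r) = m (2 * r))"
      if "rep s m" "m (2 * d) = j" "m (2 * d + 2) = ?n" "j \<le> ?n" for j s and m :: "nat \<Rightarrow> nat"
      using that(4,1-3)
    proof (induction j arbitrary: s m rule: inc_induct)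
      case base
      let ?m = "m(2 * d + 4 := 0)"
      have "reaches P xs 1 (p + 3, m) (p + 4, ?m)"
        using reaches_straight[OF c(2), of xs m] base by (simp add: add.commute)
      moreover have "reaches P xs 1 (p + 4, ?m) (p1 + 3, ?m)"
        using reaches_step[of "p + 4" P "JumpZero (2 * d + 4) (p1 + 3)" xs ?m] c(3) by (simp add: add.commute)
      ultimately have "reaches P xs (1 + 1) (p + 3, m) (p1 + 3, ?m)"
        by (rule reaches_trans)
      then have "reaches P xs 2 (p + 3, m) (p1 + 3, ?m)"
        by (simp only: one_add_one)
      moreover have "rep s ?m"
        using base(1) addr_neq_double by (simp add: rep_def)
      ultimately show ?case
        by (intro exI[of _ ?m]) (simp add: fun_upd_def)
    next
      case (step j)
      let ?m = "m(2 * d + 4 := ?n - j)"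
      let ?m1 = "?m(addr x 0 := j)"
      have "reaches P xs 1 (p + 3, m) (p + 4, ?m)"
        using reaches_straight[OF c(2), of xs m] step.prems by (simp add: add.commute)
      moreover have "reaches P xs 1 (p + 4, ?m) (p + 5, ?m)"
        using reaches_step[of "p + 4" P "JumpZero (2 * d + 4) (p1 + 3)" xs ?m] c(3) step.hyps by (simp add: add.commute)
      ultimately have "reaches P xs (1 + 1) (p + 3, m) (p + 5, ?m)"
        by (rule reaches_trans)
      moreover have "reaches P xs 1 (p + 5, ?m) (p + 6, ?m1)"
        using reaches_straight[OF c(4), of xs ?m] step.prems by (simp add: add.commute)
      ultimately have r1: "reaches P xs (1 + 1 + 1) (p + 3, m) (p + 6, ?m1)"
        by (rule reaches_trans)
      have "rep (upd s x 0 j) ?m1"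
        using step.prems(1)
        by (rule rep_upd) (use addr_neq_double addr_eq_iff in auto)
      from q[OF *(1) c(5) this] obtain m2 where
        m2: "reaches P xs (poly q ?n) (p + 6, ?m1) (p1, m2)" "rep (?f j s) m2"
          "\<forall>r<d+2. m2 (2 * r) = ?m1 (2 * r)"
        unfolding p1_def by blast
      let ?m3 = "m2(2 * d + 4 := 1, 2 * d := Suc j)"
      \<comment> \<open>The body was compiled at depth \<open>d + 2\<close>, so it preserves the
        registers \<open>2 * d\<close> and \<open>2 * d + 2\<close>.\<close>
      have m2d: "m2 (2 * d) = j" "m2 (2 * d + 2) = ?n"
        using m2(3)[rule_format, of d] m2(3)[rule_format, of "d + 1"] step.prems addr_neq_double
        by auto
      have "reaches P xs (Suc (Suc 0)) (p1, m2) (p1 + 2, ?m3)"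
        using reaches_straight[OF c(6), of xs m2] m2d by simp
      moreover have "reaches P xs 1 (p1 + 2, ?m3) (p + 3, ?m3)"
        using reaches_step[of "p1 + 2" P "Jump (p + 3)" xs ?m3] c(7) by simp
      ultimately have r2: "reaches P xs (Suc (Suc 0) + 1) (p1, m2) (p + 3, ?m3)"
        by (rule reaches_trans)
      have "rep (?f j s) ?m3"
        using m2(2) addr_neq_double
        by (simp add: rep_def)
      moreover have "?m3 (2 * d) = Suc j" "?m3 (2 * d + 2) = ?n"
        using m2d by simp_all
      ultimately obtain m4 where
        m4: "reaches P xs (2 + (?n - Suc j) * (6 + poly q ?n)) (p + 3, ?m3) (p1 + 3, m4)"
        "rep (fold ?f [Suc j..<?n] (?f j s)) m4" "\<forall>r<d. m4 (2 * r) = ?m3 (2 * r)"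
        using step.IH by blast
      have "reaches P xs (1 + 1 + 1 + poly q ?n + (Suc (Suc 0) + 1) + (2 + (?n - Suc j) * (6 + poly q ?n)))
          (p + 3, m) (p1 + 3, m4)"
        by (rule reaches_trans[OF reaches_trans[OF reaches_trans[OF r1 m2(1)] r2] m4(1)])
      moreover have "?n - j = Suc (?n - Suc j)"
        using step.hyps by simp
      ultimately have "reaches P xs (2 + (?n - j) * (6 + poly q ?n)) (p + 3, m) (p1 + 3, m4)"
        by (elim reaches_mono) simp
      moreover have "m4 (2 * r) = m (2 * r)" if "r < d" for r
        using that m4(3) m2(3) addr_neq_double by simp
      ultimately show ?case
        using m4(2) step.hyps by (intro exI[of _ m4]) (simp add: upt_conv_Cons)
    qed
    let ?m = "m(2 * d := 0, 2 * d + 2 := ?n)"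
    have "reaches P xs 3 (p, m) (p + 3, ?m)"
      using reaches_straight[OF c(1), of xs m] *(1) by (simp add: numeral_eq_Suc)
    moreover have "rep s ?m"
      using *(3) addr_neq_double by (simp add: rep_def)
    from loop[OF this, of 0] obtain m' where
      m': "reaches P xs (2 + ?n * (6 + poly q ?n)) (p + 3, ?m) (p1 + 3, m')"
        "rep (sem xs (For x c) s) m'" "\<forall>r<d. m' (2 * r) = ?m (2 * r)"
      by auto
    ultimately have "reaches P xs (3 + (2 + ?n * (6 + poly q ?n))) (p, m) (p1 + 3, m')"
      by (blast intro: reaches_trans)
    then show "\<exists>m'. reaches P xs (poly ([:5:] + [:0, 1:] * ([:6:] + q)) (xs ! 0)) (p, m)
         (p + length (comp (For x c) d p), m') \<and>
         rep (sem xs (For x c) s) m' \<and> (\<forall>r<d. m' (2 * r) = m (2 * r))"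
      using m' unfolding p1 by (intro exI[of _ m']) (auto simp: numeral_eq_Suc)
  qed
qed

lemma poly_nat_mono: "x \<le> y \<Longrightarrow> poly p x \<le> poly (p :: nat poly) y"
  by (induction p) (auto intro!: add_mono mult_le_mono)

text \<open>The result expression is compiled at depth \<open>0\<close>, so its value ends in
  register \<open>0\<close>, which decides acceptance. The time bound in terms of the first input
  number becomes one in the input size by monotonicity.\<close>

lemma poly_time_solvable_onI:
  assumes size: "\<And>x. x \<in> A \<Longrightarrow> enc x \<noteq> [] \<and> enc x ! 0 \<le> input_size (enc x)"
    and yes: "\<And>x. x \<in> A \<Longrightarrow> aval (enc x) e (sem (enc x) c (\<lambda>_ _. 0)) \<noteq> 0 \<longleftrightarrow> yes x"
  shows "poly_time_solvable_on enc yes A"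
proof -
  let ?C = "comp c 0 0" and ?E = "comp_aexp e 0"
  let ?P = "?C @ ?E"
  obtain q where q: "simulates c 0 q"
    using comp_correct[of c 0] by blast
  show ?thesis
    unfolding poly_time_solvable_on_def
  proof (intro exI[of _ ?P] exI[of _ "q + [:length ?E:]"] ballI)
    fix x assume x: "x \<in> A"
    let ?xs = "enc x"
    have "code_at ?P 0 ?C" "code_at ?P (length ?C) ?E"
      using code_at_self[of "[]" ?C ?E] code_at_self[of ?C ?E "[]"] by simp_all
    from this(1) obtain m where
      m: "reaches ?P ?xs (poly q (?xs ! 0)) (0, \<lambda>_. 0) (length ?C, m)" "rep (sem ?xs c (\<lambda>_ _. 0)) m"
      using simulatesD[OF q, of ?xs ?P 0 "\<lambda>_ _. 0" "\<lambda>_. 0"] size[OF x] by (auto simp: rep_def)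
    have "reaches ?P ?xs (length ?E) (length ?C, m) (length ?C + length ?E, effect ?xs ?E m)"
      by (rule reaches_straight[OF \<open>code_at ?P (length ?C) ?E\<close> straight_comp_aexp])
    from reaches_trans[OF m(1) this] obtain t where
      t: "t \<le> poly q (?xs ! 0) + length ?E"
        "ram_run ?P ?xs t = (length ?C + length ?E, effect ?xs ?E m)"
      by (auto simp: reaches_def ram_run_def)
    have "effect ?xs ?E m 0 = aval ?xs e (sem ?xs c (\<lambda>_ _. 0))"
      using effect_comp_aexp[OF m(2), of ?xs e 0] by simp
    then have "halted ?P (ram_run ?P ?xs t) \<and> (accepting (ram_run ?P ?xs t) \<longleftrightarrow> yes x)"
      using t(2) yes[OF x] by (simp add: halted_def accepting_def)
    moreover have "t \<le> poly (q + [:length ?E:]) (input_size ?xs)"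
      using t(1) poly_nat_mono[of "?xs ! 0" "input_size ?xs" q] size[OF x] by simp
    ultimately show "\<exists>t\<le>poly (q + [:length ?E:]) (input_size ?xs).
        halted ?P (ram_run ?P ?xs t) \<and> (accepting (ram_run ?P ?xs t) \<longleftrightarrow> yes x)"
      by blast
  qed
qed

section \<open>The algorithm\<close>

abbreviation Var :: "var \<Rightarrow> aexp" where
  "Var x \<equiv> Arr x (N 0)"

abbreviation Set_Var :: "var \<Rightarrow> aexp \<Rightarrow> com" where
  "Set_Var x e \<equiv> Assign x (N 0) e"

abbreviation When :: "aexp \<Rightarrow> com \<Rightarrow> com" where
  "When e c \<equiv> Cond e c Skip"

text \<open>As subtraction is truncated, at least one of the two differences is \<open>0\<close>.
  Truncation also makes the next two definitions yield the maximum and the minimum with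
  \<open>1\<close>.\<close>

definition Neq :: "aexp \<Rightarrow> aexp \<Rightarrow> aexp" where
  "Neq e f = Plus (Minus e f) (Minus f e)"

definition Maximum :: "aexp \<Rightarrow> aexp \<Rightarrow> aexp" where
  "Maximum e f = Plus e (Minus f e)"

definition Min1 :: "aexp \<Rightarrow> aexp" where
  "Min1 e = Minus e (Minus e (N 1))"

abbreviation Adj :: "var \<Rightarrow> var \<Rightarrow> aexp" where
  "Adj x y \<equiv> Inp (Plus (Arr Row (Var x)) (Var y))"

lemma aval_derived [simp]:
  "aval xs (Neq e f) s \<noteq> 0 \<longleftrightarrow> aval xs e s \<noteq> aval xs f s"
  "aval xs (Neq e f) s = 0 \<longleftrightarrow> aval xs e s = aval xs f s"
  "aval xs (Maximum e f) s = max (aval xs e s) (aval xs f s)"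
  "aval xs (Min1 e) s = min 1 (aval xs e s)"
  by (auto simp: Neq_def Maximum_def Min1_def)

text \<open>\<open>Off\<close> starts behind \<open>n\<close>, \<open>k\<close> and the indicator
  vector of \<open>T\<close>, and grows by \<open>n\<close> per row, which computes the row
  positions by additions only.\<close>

definition init :: com where
  "init = Set_Var Off (Plus (N 2) (Inp (N 0)));;
     For I (Assign Row (Var I) (Var Off);; Set_Var Off (Plus (Var Off) (Inp (N 0)));;
       Assign Alive (Var I) (N 1);; Assign Al (Var I) (N 1);; Assign Be (Var I) (N 1);;
       Assign Ga (Var I) (N 1);; Assign Ta (Var I) (Minus (N 1) (Inp (Plus (N 2) (Var I)))))"

definition twin_check :: com where
  "twin_check = When (Arr Alive (Var W)) (When (Neq (Var W) (Var U)) (When (Neq (Var W) (Var V))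
     (When (Neq (Adj U W) (Adj V W)) (Set_Var Ok (N 0)))))"

definition twin_test :: com where
  "twin_test = Set_Var Ok (N 1);; For W twin_check"

text \<open>The order matters: the new \<open>Ga\<close> uses all four old values and the new
  \<open>Be\<close> uses the old \<open>Ta\<close>, so \<open>Ga\<close> comes first and
  \<open>Ta\<close> last.\<close>

definition join :: com where
  "join =
     (let a = Arr Al (Var U); a' = Arr Al (Var V); b = Arr Be (Var U); b' = Arr Be (Var V);
          g = Arr Ga (Var U); g' = Arr Ga (Var V); t = Arr Ta (Var U); t' = Arr Ta (Var V)
      in Assign Ga (Var U)
           (Maximum (Maximum (Maximum g g') (Maximum (Plus t t') (Plus a a')))
             (Maximum (Plus (Min1 t) b') (Plus (Min1 t') b)));;
         Assign Be (Var U) (Maximum (Maximum b b') (Plus t t'));;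
         Assign Al (Var U) (Maximum a a');;
         Assign Ta (Var U) (Plus t t'))"

definition union :: com where
  "union =
     (let add = \<lambda>x. Assign x (Var U) (Plus (Arr x (Var U)) (Arr x (Var V)))
      in add Ga;; add Be;; add Al;; add Ta)"

definition merge :: com where
  "merge = Cond (Adj U V) join union;; Assign Alive (Var V) (N 0)"

definition visit :: com where
  "visit = When (Arr Alive (Var U)) (When (Arr Alive (Var V)) (When (Neq (Var U) (Var V))
     (twin_test;; When (Var Ok) merge)))"

text \<open>As many rounds as vertices are enough on \<open>P4\<close>-free graphs, since each round
  merges some pair while two vertices are alive. Afterwards \<open>Off\<close> is reused to add up
  \<open>k\<close> and the value \<open>Ga\<close> of the only survivor; a loop over all vertices
  finds it and also covers the empty graph.\<close>

definition soct_prog :: com where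
  "soct_prog = init;; For I (For U (For V visit));; Set_Var Off (Inp (N 1));;
     For I (When (Arr Alive (Var I)) (Set_Var Off (Plus (Var Off) (Arr Ga (Var I)))))"

text \<open>With truncated subtraction this is nonzero iff the number of vertices is at most
  \<open>Off\<close>, which then holds \<open>k\<close> plus the optimum.\<close>

definition soct_result :: aexp where
  "soct_result = Minus (Plus (Var Off) (N 1)) (Inp (N 0))"

lemma nth_concat_uniform:
  "\<forall>xs\<in>set xss. length xs = n \<Longrightarrow> i < length xss \<Longrightarrow> j < n \<Longrightarrow> concat xss ! (i * n + j) = xss ! i ! j"
proof (induction xss arbitrary: i)
  case (Cons xs xss)
  then show ?case
    by (cases i) (auto simp: nth_append)
qed simp

lemma length_concat_uniform:
  "\<forall>xs\<in>set xss. length xs = n \<Longrightarrow> length (concat xss) = length xss * n"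
  by (induction xss) auto

lemma fold_upt_invariant:
  assumes "P 0 s" "\<And>i s. i < n \<Longrightarrow> P i s \<Longrightarrow> P (Suc i) (f i s)"
  shows "P n (fold f [0..<n] s)"
proof -
  have "m \<le> n \<Longrightarrow> P m (fold f [0..<m] s)" for m
    using assms by (induction m) auto
  then show ?thesis by simp
qed

lemma upd_apply: "upd s a i x b = (if b = a then (s a)(i := x) else s b)"
  by (simp add: upd_def)

lemma sem_union:
  "sem xs union s x = (if x \<in> {Al, Be, Ga, Ta}
     then (s x)(s U 0 := s x (s U 0) + s x (s V 0)) else s x)"
  by (cases x) (simp_all add: union_def Let_def upd_apply)

lemma sem_join:
  fixes xs and s :: state
  defines "u \<equiv> s U 0" and "v \<equiv> s V 0" and "s' \<equiv> sem xs join s"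
  shows "s' Al = (s Al)(u := max (s Al u) (s Al v))"
    and "s' Be = (s Be)(u := max (max (s Be u) (s Be v)) (s Ta u + s Ta v))"
    and "s' Ga = (s Ga)(u := max (max (max (s Ga u) (s Ga v)) (max (s Ta u + s Ta v) (s Al u + s Al v)))
      (max (min 1 (s Ta u) + s Be v) (min 1 (s Ta v) + s Be u)))"
    and "s' Ta = (s Ta)(u := s Ta u + s Ta v)"
    and "x \<notin> {Al, Be, Ga, Ta} \<Longrightarrow> s' x = s x"
  by (simp_all add: u_def v_def s'_def join_def Let_def upd_apply)

section \<open>Correctness of the algorithm on \<open>P4\<close>-free instances\<close>

locale soct =
  fixes G :: "nat graph" and T :: "nat set" and k n :: nat
  assumes G: "simple_graph G" and verts: "verts G = {..<n}" and T: "T \<subseteq> {..<n}"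
    and P4_free: "free_of (path_graph 4) G"
begin

definition xs :: "nat list" where
  "xs = soct_encode (G, T, k)"

abbreviation rows :: "nat list list" where
  "rows \<equiv> map (\<lambda>i. map (\<lambda>j. of_bool (adj G i j)) [0..<n]) [0..<n]"

lemma xs_eq: "xs = n # k # map (\<lambda>i. of_bool (i \<in> T)) [0..<n] @ concat rows"
  by (simp add: xs_def soct_encode_def verts Let_def)

lemma nth_xs [simp]: "xs ! 0 = n" "xs ! Suc 0 = k" "xs \<noteq> []" "Suc 0 < length xs"
  by (simp_all add: xs_eq)

lemma nth_xs_T: "i < n \<Longrightarrow> xs ! Suc (Suc i) = of_bool (i \<in> T)" "i < n \<Longrightarrow> Suc (Suc i) < length xs"
  by (simp_all add: xs_eq nth_append)

lemma nth_xs_adj: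
  assumes "i < n" "j < n"
  shows "2 + n + i * n + j < length xs" "xs ! (2 + n + i * n + j) = of_bool (adj G i j)"
proof -
  have "i * n + j < Suc i * n"
    using assms by simp
  also have "\<dots> \<le> n * n"
    using assms by (intro mult_le_mono1) simp
  finally have l: "i * n + j < n * n" .
  have "length (concat rows) = n * n"
    using length_concat_uniform[of rows n] by simp
  then show "2 + n + i * n + j < length xs"
    using l by (simp add: xs_eq)
  have "concat rows ! (i * n + j) = of_bool (adj G i j)"
    using nth_concat_uniform[of rows n i j] assms by simp
  then show "xs ! (2 + n + i * n + j) = of_bool (adj G i j)"
    by (simp add: xs_eq nth_append add.assoc)
qed

text \<open>Every input number has length at least \<open>1\<close>, and \<open>xs\<close> has more
  than \<open>n\<close> entries. This keeps loops over \<open>n\<close> polynomial although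
  \<open>n\<close> is given in binary.\<close>

lemma n_le_input_size: "n \<le> input_size xs"
proof -
  have "length ys \<le> input_size ys" for ys
    by (induction ys) (auto simp: input_size_def)
  from this[of xs] show ?thesis
    by (simp add: xs_eq)
qed

definition alive :: "state \<Rightarrow> nat set" where
  "alive s = {u. u < n \<and> s Alive u \<noteq> 0}"

definition rows_ok :: "state \<Rightarrow> bool" where
  "rows_ok s \<longleftrightarrow> (\<forall>i<n. s Row i = 2 + n + i * n)"

text \<open>\<open>M u\<close> is the set of vertices that have been merged into the representative \<open>u\<close>.\<close>

definition modules :: "state \<Rightarrow> (nat \<Rightarrow> nat set) \<Rightarrow> bool" where
  "modules s M \<longleftrightarrow> (\<Union>u\<in>alive s. M u) = {..<n} \<and>
     (\<forall>u\<in>alive s. \<forall>v\<in>alive s. u \<noteq> v \<longrightarrow>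
        M u \<inter> M v = {} \<and> (\<forall>x\<in>M u. \<forall>y\<in>M v. adj G x y = adj G u v)) \<and>
     (\<forall>u\<in>alive s. opt_values G T (M u) (s Al u) (s Be u) (s Ga u) (s Ta u))"

definition inv :: "state \<Rightarrow> bool" where
  "inv s \<longleftrightarrow> rows_ok s \<and> (\<exists>M. modules s M)"

lemma alive_less: "u \<in> alive s \<Longrightarrow> u < n"
  by (simp add: alive_def)

lemma finite_alive: "finite (alive s)"
  by (rule finite_subset[of _ "{..<n}"]) (auto simp: alive_def)

lemma inv_cong:
  assumes "\<forall>x\<in>{Row, Alive, Al, Be, Ga, Ta}. s' x = s x"
  shows "inv s' = inv s" "alive s' = alive s"
proof -
  show a: "alive s' = alive s"
    using assms by (simp add: alive_def)
  show "inv s' = inv s"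
    unfolding inv_def modules_def rows_ok_def a using assms by simp
qed

lemma aval_Adj:
  assumes "rows_ok s" "s x 0 < n" "s y 0 < n"
  shows "aval xs (Adj x y) s = of_bool (adj G (s x 0) (s y 0))"
  using assms nth_xs_adj[of "s x 0" "s y 0"] by (simp add: rows_ok_def)

lemma sem_init:
  assumes "s' = sem xs init s"
  shows "inv s'" "alive s' = {..<n}"
proof -
  define P where "P j s \<longleftrightarrow> s Off 0 = 2 + n + j * n \<and>
    (\<forall>i<j. s Row i = 2 + n + i * n \<and> s Alive i = 1 \<and> s Al i = 1 \<and> s Be i = 1 \<and> s Ga i = 1 \<and>
       s Ta i = 1 - of_bool (i \<in> T))" for j and s :: state
  have "P n s'"
    unfolding assms init_def sem.simps nth_xs
  proof (rule fold_upt_invariant[where P = P], goal_cases)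
    case 1
    show ?case by (simp add: P_def upd_apply)
  next
    case (2 i s)
    then show ?case
      using nth_xs_T[of i] by (simp add: P_def upd_apply less_Suc_eq)
  qed
  then have P: "rows_ok s'" "\<And>i. i < n \<Longrightarrow> s' Alive i = 1 \<and> s' Al i = 1 \<and> s' Be i = 1 \<and>
      s' Ga i = 1 \<and> s' Ta i = 1 - of_bool (i \<in> T)"
    by (auto simp: P_def rows_ok_def)
  then show a: "alive s' = {..<n}"
    by (auto simp: alive_def)
  have "modules s' (\<lambda>u. {u})"
    unfolding modules_def a using P(2) opt_values_singleton[OF G, of T] by auto
  with P(1) show "inv s'"
    by (auto simp: inv_def)
qed

lemma sem_twin_test:
  assumes s: "rows_ok s" "s U 0 < n" "s V 0 < n" and s': "s' = sem xs twin_test s"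
  shows "x \<notin> {W, Ok} \<Longrightarrow> s' x = s x"
    and "s' Ok 0 \<noteq> 0 \<longleftrightarrow>
      (\<forall>w\<in>alive s - {s U 0, s V 0}. adj G (s U 0) w = adj G (s V 0) w)"
proof -
  define P where "P j s' \<longleftrightarrow> (\<forall>x. x \<notin> {W, Ok} \<longrightarrow> s' x = s x) \<and> (s' Ok 0 \<noteq> 0 \<longleftrightarrow>
      (\<forall>w<j. w \<in> alive s - {s U 0, s V 0} \<longrightarrow> adj G (s U 0) w = adj G (s V 0) w))"
    for j and s' :: state
  have "P n s'"
    unfolding s' twin_test_def sem.simps nth_xs
  proof (rule fold_upt_invariant[where P = P], goal_cases)
    case 1
    show ?case by (simp add: P_def upd_apply)
  next
    case (2 w s')
    define t where "t = upd s' W 0 w"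
    have t: "t x = s x" if "x \<notin> {W, Ok}" for x
      using 2 that by (simp add: P_def t_def upd_apply)
    have tW: "t W 0 = w" and tOk: "t Ok = s' Ok"
      by (simp_all add: t_def upd_apply)
    have "rows_ok t"
      using s(1) t by (simp add: rows_ok_def)
    then have A: "aval xs (Adj U W) t = of_bool (adj G (s U 0) w)"
      "aval xs (Adj V W) t = of_bool (adj G (s V 0) w)"
      using aval_Adj[of t U W] aval_Adj[of t V W] s t tW 2(1) by simp_all
    have al: "t Alive w \<noteq> 0 \<longleftrightarrow> w \<in> alive s"
      using t 2(1) by (simp add: alive_def)
    have fin: "P (Suc w) (if w \<in> alive s - {s U 0, s V 0} \<and> adj G (s U 0) w \<noteq> adj G (s V 0) w
        then upd t Ok 0 0 else t)"
      using 2(2) t tOk unfolding P_def by (auto simp: upd_apply less_Suc_eq)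
    have "sem xs twin_check t =
       (if w \<in> alive s - {s U 0, s V 0} \<and> adj G (s U 0) w \<noteq> adj G (s V 0) w
        then upd t Ok 0 0 else t)"
      unfolding twin_check_def sem.simps aval_derived A
      using t[of U] t[of V] tW al by (auto simp: of_bool_def)
    with fin show ?case
      by (simp only: t_def)
  qed
  then show "x \<notin> {W, Ok} \<Longrightarrow> s' x = s x"
    "s' Ok 0 \<noteq> 0 \<longleftrightarrow> (\<forall>w\<in>alive s - {s U 0, s V 0}. adj G (s U 0) w = adj G (s V 0) w)"
    by (auto simp: P_def dest: alive_less)
qed

lemma modulesD:
  assumes "modules s M"
  shows "(\<Union>u\<in>alive s. M u) = {..<n}"
    and "u \<in> alive s \<Longrightarrow> v \<in> alive s \<Longrightarrow> u \<noteq> v \<Longrightarrow> M u \<inter> M v = {}"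
    and "u \<in> alive s \<Longrightarrow> v \<in> alive s \<Longrightarrow> u \<noteq> v \<Longrightarrow> x \<in> M u \<Longrightarrow> y \<in> M v \<Longrightarrow>
      adj G x y = adj G u v"
    and "u \<in> alive s \<Longrightarrow> opt_values G T (M u) (s Al u) (s Be u) (s Ga u) (s Ta u)"
  using assms unfolding modules_def by simp_all

text \<open>The merged module keeps \<open>u\<close> as representative: towards any third module,
  the vertices of \<open>M v\<close> behave like \<open>v\<close>, hence like its twin
  \<open>u\<close>.\<close>

lemma modules_merge:
  assumes M: "modules s M" and tw: "twins (adj G) (alive s) u v"
    and al: "alive s' = alive s - {v}"
    and same: "\<And>x w. x \<in> {Al, Be, Ga, Ta} \<Longrightarrow> w \<noteq> u \<Longrightarrow> s' x w = s x w"
    and val: "opt_values G T (M u \<union> M v) (s' Al u) (s' Be u) (s' Ga u) (s' Ta u)"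
  shows "modules s' (M(u := M u \<union> M v))"
proof -
  let ?M = "M(u := M u \<union> M v)"
  have uv: "u \<in> alive s" "v \<in> alive s" "u \<noteq> v"
    and tw': "\<And>w. w \<in> alive s \<Longrightarrow> w \<noteq> u \<Longrightarrow> w \<noteq> v \<Longrightarrow> adj G u w = adj G v w"
    using tw by (auto simp: twins_def)
  note M1 = modulesD(1)[OF M] and M2 = modulesD(2)[OF M] and M3 = modulesD(3)[OF M]
    and M4 = modulesD(4)[OF M]
  have 1: "(\<Union>a\<in>alive s'. ?M a) = {..<n}"
    using uv unfolding al M1[symmetric] by auto
  have 2: "?M a \<inter> ?M b = {}" if "a \<in> alive s'" "b \<in> alive s'" "a \<noteq> b" for a b
    using that uv M2[of a b] M2[of v b] M2[of a v] unfolding al by auto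
  have 3: "adj G x y = adj G a b"
    if xy: "a \<in> alive s'" "b \<in> alive s'" "a \<noteq> b" "x \<in> ?M a" "y \<in> ?M b" for a b x y
  proof -
    have ab: "a \<in> alive s" "b \<in> alive s" "a \<noteq> v" "b \<noteq> v"
      using xy(1,2) unfolding al by auto
    consider "x \<in> M a" "y \<in> M b" | "a = u" "x \<in> M v" "y \<in> M b" | "b = u" "y \<in> M v" "x \<in> M a"
      using xy(3-5) by (auto split: if_splits)
    then show ?thesis
    proof cases
      case 1
      then show ?thesis using M3 ab xy(3) by blast
    next
      case 2
      then show ?thesis
        using M3[of v b x y] ab uv tw'[of b] xy(3) by simp
    next
      case 3
      then show ?thesis
        using M3[of a v x y] ab uv tw'[of a] xy(3) by (simp add: adj_commute)
    qed
  qed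
  have 4: "opt_values G T (?M a) (s' Al a) (s' Be a) (s' Ga a) (s' Ta a)"
    if "a \<in> alive s'" for a
    using that M4[of a] val same unfolding al by auto
  show ?thesis
    unfolding modules_def by (intro conjI ballI impI 1 2 3 4)
qed

lemma sem_merge:
  assumes s: "inv s" and tw: "twins (adj G) (alive s) (s U 0) (s V 0)"
    and s': "s' = sem xs merge s"
  shows "inv s'" "alive s' = alive s - {s V 0}" "s' U = s U"
proof -
  let ?u = "s U 0" and ?v = "s V 0"
  obtain M where M: "modules s M" and rows: "rows_ok s"
    using s by (auto simp: inv_def)
  have uv: "?u \<in> alive s" "?v \<in> alive s" "?u \<noteq> ?v"
    using tw by (auto simp: twins_def)
  have A: "aval xs (Adj U V) s = of_bool (adj G ?u ?v)"
    using aval_Adj[of s U V] rows uv by (simp add: alive_less)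
  have "M a \<subseteq> {..<n}" if "a \<in> alive s" for a
    using modulesD(1)[OF M] that by blast
  then have fin: "finite (M ?u)" "finite (M ?v)"
    using uv by (meson finite_lessThan finite_subset)+
  note disj = modulesD(2)[OF M uv] and unif = modulesD(3)[OF M uv]
    and vals = modulesD(4)[OF M uv(1)] modulesD(4)[OF M uv(2)]
  define c where "c = (if adj G ?u ?v then join else union)"
  have s'_eq: "s' = upd (sem xs c s) Alive (sem xs c s V 0) 0"
    using A unfolding s' merge_def c_def sem.simps by simp
  have c_same: "sem xs c s x = s x" if "x \<in> {U, V, Row, Alive}" for x
    using that by (auto simp: c_def sem_union sem_join(5))
  have s'U: "s' U = s U"
    and "rows_ok s'" and al: "alive s' = alive s - {?v}"
    using rows c_same by (auto simp: s'_eq upd_apply rows_ok_def alive_def)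
  have same: "s' x w = s x w" if "x \<in> {Al, Be, Ga, Ta}" "w \<noteq> ?u" for x w
    using that by (auto simp: s'_eq upd_apply c_def sem_union sem_join)
  have "opt_values G T (M ?u \<union> M ?v) (s' Al ?u) (s' Be ?u) (s' Ga ?u) (s' Ta ?u)"
  proof (cases "adj G ?u ?v")
    case True
    then have "completely_adjacent G (M ?u) (M ?v)"
      using unif by (simp add: completely_adjacent_def)
    from opt_values_join[OF G this fin disj vals] show ?thesis
      using True uv(3)
      by (simp add: s'_eq c_def upd_apply sem_join)
  next
    case False
    then have "nowhere_adjacent G (M ?u) (M ?v)"
      using unif by (simp add: nowhere_adjacent_def)
    from opt_values_union[OF this fin disj vals] show ?thesis
      using False uv(3) by (simp add: s'_eq c_def upd_apply sem_union)
  qed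
  from modules_merge[OF M tw al same this] \<open>rows_ok s'\<close> s'U al
  show "inv s'" "alive s' = alive s - {?v}" "s' U = s U"
    by (auto simp: inv_def)
qed

text \<open>A pair of twins always passes the test and loses its second vertex, so a visit without
  effect rules out this pair; \<open>sem_round\<close> collects these facts.\<close>

lemma sem_visit:
  assumes s: "inv s" "s U 0 < n" "s V 0 < n" and s': "s' = sem xs visit s"
  shows "inv s'" "s' U = s U" "alive s' \<subseteq> alive s"
    and "alive s' = alive s \<Longrightarrow> \<not> twins (adj G) (alive s) (s U 0) (s V 0)"
proof -
  let ?u = "s U 0" and ?v = "s V 0"
  define t where "t = sem xs twin_test s"
  have rows: "rows_ok s"
    using s by (simp add: inv_def)
  note tt = sem_twin_test[OF rows s(2,3) t_def]
  have t: "inv t = inv s" "alive t = alive s" "t U = s U" "t V = s V"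
    using inv_cong[of t s] tt(1) by simp_all
  have "(inv s' \<and> s' U = s U) \<and>
      alive s' = (if twins (adj G) (alive s) ?u ?v then alive s - {?v} else alive s)"
  proof (cases "?u \<in> alive s \<and> ?v \<in> alive s \<and> ?u \<noteq> ?v")
    case False
    then have "s' = s"
      using s(2,3) unfolding s' visit_def by (auto simp: alive_def)
    then show ?thesis
      using False s(1) by (auto simp: twins_def)
  next
    case True
    then have s'_eq: "s' = (if t Ok 0 \<noteq> 0 then sem xs merge t else t)"
      unfolding s' visit_def t_def by (auto simp: alive_def)
    have tw: "twins (adj G) (alive s) ?u ?v \<longleftrightarrow> t Ok 0 \<noteq> 0"
      using True tt(2) by (auto simp: twins_def)
    show ?thesis
    proof (cases "t Ok 0 = 0")
      case True
      then show ?thesis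
        using s'_eq tw t s(1) by simp
    next
      case False
      then show ?thesis
        using sem_merge[of t s'] tw t s(1) s'_eq by simp
    qed
  qed
  then show "inv s'" "s' U = s U" "alive s' \<subseteq> alive s"
    "alive s' = alive s \<Longrightarrow> \<not> twins (adj G) (alive s) ?u ?v"
    by (auto simp: twins_def split: if_splits)
qed

text \<open>If nothing were merged during a round, all pairs would have been tested against the same
  set \<open>alive s\<close>, contradicting \<open>P4_free_twins\<close>.\<close>

lemma sem_round:
  assumes s: "inv s" and s': "s' = sem xs (For U (For V visit)) s"
  shows "inv s'" "alive s' \<subseteq> alive s" "card (alive s) \<ge> 2 \<Longrightarrow> card (alive s') < card (alive s)"
proof -
  \<comment> \<open>Since \<open>alive\<close> only shrinks, equality after \<open>i\<close> values
    of \<open>U\<close> means that it never changed, so every pair so far was tested on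
    \<open>alive s\<close>.\<close>
  define P where "P i t \<longleftrightarrow> inv t \<and> alive t \<subseteq> alive s \<and>
    (alive t = alive s \<longrightarrow> (\<forall>u<i. \<forall>v<n. \<not> twins (adj G) (alive s) u v))" for i t
  have P: "P n s'"
    unfolding s' sem.simps(5)[of xs U] nth_xs
  proof (rule fold_upt_invariant[where P = P], goal_cases)
    case 1
    show ?case using s by (simp add: P_def)
  next
    case (2 u t)
    define t' where "t' = upd t U 0 u"
    define Q where "Q j r \<longleftrightarrow> inv r \<and> r U 0 = u \<and> alive r \<subseteq> alive t \<and>
      (alive r = alive t \<longrightarrow> (\<forall>v<j. \<not> twins (adj G) (alive t) u v))" for j r
    have t': "inv t' = inv t" "alive t' = alive t" "t' U 0 = u"
      using inv_cong[of t' t] by (simp_all add: t'_def upd_apply)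
    have "Q n (sem xs (For V visit) t')"
      unfolding sem.simps nth_xs
    proof (rule fold_upt_invariant[where P = Q], goal_cases)
      case 1
      show ?case using t' 2(2) by (simp add: Q_def P_def)
    next
      case (2 v r)
      define r' where "r' = upd r V 0 v"
      have r': "inv r'" "alive r' = alive r" "r' U 0 = u" "r' V 0 = v"
        using inv_cong[of r' r] 2(2) by (simp_all add: r'_def upd_apply Q_def)
      note sv = sem_visit[OF r'(1) _ _ refl, unfolded r'(2-4), OF \<open>u < n\<close> 2(1)]
      show ?case
        unfolding r'_def[symmetric] using 2(2) sv r'(3) by (auto simp: Q_def less_Suc_eq)
    qed
    then show ?case
      unfolding t'_def[symmetric] using 2(2) by (auto simp: Q_def P_def less_Suc_eq)
  qed
  then show "inv s'" and sub: "alive s' \<subseteq> alive s"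
    by (auto simp: P_def)
  assume c: "card (alive s) \<ge> 2"
  have "alive s \<subseteq> verts G"
    using alive_less by (auto simp: verts)
  from free_of_P4[OF G P4_free this] obtain u v where "twins (adj G) (alive s) u v"
    using P4_free_twins[OF finite_alive c, of "adj G"] adj_commute[of _ _ G] by metis
  then have "alive s' \<noteq> alive s"
    using P alive_less unfolding P_def twins_def by blast
  then show "card (alive s') < card (alive s)"
    using sub finite_alive by (intro psubset_card_mono) auto
qed

lemma sem_rounds:
  assumes s: "inv s" and s': "s' = sem xs (For I (For U (For V visit))) s"
  shows "inv s'" "card (alive s') \<le> 1"
proof -
  \<comment> \<open>With two or more vertices alive each round removes at least one; for
    \<open>i = n\<close> both alternatives leave at most one.\<close>
  define P where "P i t \<longleftrightarrow> inv t \<and> (card (alive t) \<le> 1 \<or> card (alive t) + i \<le> n)" for i t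
  have "P n s'"
    unfolding s' sem.simps(5)[of xs I] nth_xs
  proof (rule fold_upt_invariant[where P = P], goal_cases)
    case 1
    have "card (alive s) \<le> card {..<n}"
      using alive_less by (intro card_mono) auto
    then show ?case using s by (simp add: P_def)
  next
    case (2 i t)
    define t' where "t' = upd t I 0 i"
    have t': "inv t'" "alive t' = alive t"
      using inv_cong[of t' t] 2(2) by (simp_all add: t'_def upd_apply P_def)
    note r = sem_round[OF t'(1) refl, unfolded t'(2)]
    have "card (alive (sem xs (For U (For V visit)) t')) \<le> card (alive t)"
      using r(2) finite_alive by (rule card_mono[rotated])
    then show ?case
      unfolding t'_def[symmetric] using 2(2) r(1,3) unfolding P_def by linarith
  qed
  then show "inv s'" "card (alive s') \<le> 1"
    by (auto simp: P_def)
qed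

lemma soct_prog_correct:
  "aval xs soct_result (sem xs soct_prog (\<lambda>_ _. 0)) \<noteq> 0 \<longleftrightarrow> soct_yes (G, T, k)"
proof -
  define s where "s = sem xs init (\<lambda>_ _. 0)"
  define t where "t = sem xs (For I (For U (For V visit))) s"
  define r where "r = sem xs soct_prog (\<lambda>_ _. 0)"
  have t: "inv t" "card (alive t) \<le> 1"
    using sem_rounds[OF sem_init(1)[OF s_def] t_def] by auto
  define P where "P i r \<longleftrightarrow> r Off 0 = k + (\<Sum>u\<in>alive t \<inter> {..<i}. t Ga u) \<and>
    r Ga = t Ga \<and> r Alive = t Alive" for i and r :: state
  have "P n r"
    unfolding r_def soct_prog_def sem.simps(3) s_def[symmetric] t_def[symmetric]
    unfolding sem.simps nth_xs
  proof (rule fold_upt_invariant[where P = P], goal_cases)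
    case 1
    show ?case by (simp add: P_def upd_apply)
  next
    case (2 i r)
    have "alive t \<inter> {..<Suc i} = (if t Alive i \<noteq> 0 then insert i (alive t \<inter> {..<i}) else alive t \<inter> {..<i})"
      using 2(1) by (auto simp: alive_def less_Suc_eq)
    then show ?case
      using 2 by (simp add: P_def upd_apply)
  qed
  moreover have "alive t \<inter> {..<n} = alive t"
    by (auto dest: alive_less)
  ultimately have r: "r Off 0 = k + (\<Sum>u\<in>alive t. t Ga u)"
    by (simp add: P_def)
  obtain M where M: "modules t M"
    using t by (auto simp: inv_def)
  \<comment> \<open>The sum has at most one summand, for the survivor \<open>u\<close>, whose module
    \<open>M u\<close> is the whole vertex set. No survivor means that the graph is empty, where the
    optimum is \<open>0\<close>.\<close>
  have "is_max (no_odd_T_cycle G T) (verts G) (\<Sum>u\<in>alive t. t Ga u)"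
  proof (cases "alive t = {}")
    case True
    then have "verts G = {}"
      using M by (simp add: modules_def verts)
    then show ?thesis
      using True no_odd_T_cycle_disjoint[of "{}" T G] by (simp add: is_max_def)
  next
    case False
    then have "card (alive t) = 1"
      using t(2) finite_alive[of t] by (metis card_0_eq le_less less_one)
    then obtain u where "alive t = {u}"
      by (auto simp: card_1_singleton_iff)
    then show ?thesis
      using modulesD(1)[OF M] modulesD(4)[OF M, of u] by (simp add: opt_values_def verts)
  qed
  from soct_yes_iff[OF _ this, of k] show ?thesis
    unfolding r_def[symmetric] using r by (auto simp: soct_result_def verts)
qed

end

theorem theorem8:
  "poly_time_solvable_on soct_encode soct_yes
     {(G, T, k) \<in> soct_instances. free_of (path_graph 4) G}"
proof (rule poly_time_solvable_onI[where c = soct_prog and e = soct_result])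
  fix x assume "x \<in> {(G, T, k) \<in> soct_instances. free_of (path_graph 4) G}"
  then obtain G T k n where x: "x = (G, T, k)" and "soct G T n"
    by (auto simp: soct_instances_def soct_def)
  then interpret soct G T k n by simp
  show "soct_encode x \<noteq> [] \<and> soct_encode x ! 0 \<le> input_size (soct_encode x)"
    using nth_xs n_le_input_size unfolding x xs_def[symmetric] by simp
  show "aval (soct_encode x) soct_result (sem (soct_encode x) soct_prog (\<lambda>_ _. 0)) \<noteq> 0 \<longleftrightarrow>
      soct_yes x"
    using soct_prog_correct unfolding x xs_def by simp
qed

end
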